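(* Let $\kappa$ be a regular uncountable cardinal, let $I$ be an ideal on $\kappa$, let $\gamma<\kappa$ be a limit ordinal, and let $\mathbb Q$ be a poset with domain $Q$. Then $\mathbb Q$ is ${<}\gamma^+$-strategically closed if and only if Choose has a winning strategy in $\mathcal G_\infty(X,\mathbb Q,\gamma)$ for all $X\in Q$.
   Context: Posets are assumed to have a maximal element $1_{\mathbb Q}$. (The ideal $I$ plays no role in the conclusion.) $\mathcal G_\infty(X,\mathbb Q,\gamma)$ has $\gamma$ many rounds, played by Cut and Choose: in each round, Cut plays a maximal antichain of $\mathbb Q$ below $X$ (of arbitrary size), and Choose picks one of its elements. Choose wins if the sequence of all of their choices has a lower bound in $\mathbb Q$; otherwise Cut wins. Strategic closure: for an ordinal $\alpha$, $\mathbb Q$ is $\alpha$-strategically closed if in the game of length $\alpha$ in which two players build a decreasing sequence of elements of $Q$, with player Even moving at all even stages (including $0$ and all limit stages, and playing $1_{\mathbb Q}$ at stage $0$) and player Odd moving at all odd stages, where Even loses if they are unable to move at some stage below $\alpha$ and wins otherwise, player Even has a winning strategy. $\mathbb Q$ is ${<}\gamma^+$-strategically closed if it is $\alpha$-strategically closed for every $\alpha<\gamma^+$, where $\gamma^+$ denotes the least cardinal greater than $\gamma$. Equivalently, in the Banach-Mazur game of length $\gamma$ on $\mathbb Q$, in which players Empty and Nonempty alternately play a decreasing sequence of elements of $Q$ (Empty starting, Nonempty playing first at limit stages, Empty winning if Nonempty cannot move at a limit stage below $\gamma$), and in which Nonempty wins if the sequence of all moves has a lower bound in $\mathbb Q$,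 Nonempty has a winning strategy. *)

theory Defs
  imports Main "HOL-Library.FuncSet"
begin

unbundle cardinal_syntax

text \<open>Ordinals are represented by well-order relations on arbitrary types: the elements of
  \<open>Field r\<close> are the ordinals below the ordinal represented by \<open>r\<close>, and serve as the stages of a
  game of that length. Posets are types of class \<open>order_top\<close>; the top element is the
  distinguished element 1 of the poset.\<close>

definition limit_ordinal :: "'a rel \<Rightarrow> bool" where
  "limit_ordinal r \<longleftrightarrow>
     Well_order r \<and> Field r \<noteq> {} \<and> (\<forall>a\<in>Field r. aboveS r a \<noteq> {})"

definition ideal_on :: "'a set \<Rightarrow> 'a set set \<Rightarrow> bool" where
  "ideal_on K I \<longleftrightarrow>
     I \<subseteq> Pow K \<and> {} \<in> I \<and> K \<notin> I \<and>
     (\<forall>A\<in>I. \<forall>B. B \<subseteq> A \<longrightarrow> B \<in> I) \<and>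
     (\<forall>A\<in>I. \<forall>B\<in>I. A \<union> B \<in> I)"


section \<open>The cut and choose game\<close>

definition compat :: "'q::order \<Rightarrow> 'q \<Rightarrow> bool" where
  "compat p q \<longleftrightarrow> (\<exists>r. r \<le> p \<and> r \<le> q)"

definition antichain_below :: "'q::order \<Rightarrow> 'q set \<Rightarrow> bool" where
  "antichain_below X A \<longleftrightarrow>
     (\<forall>a\<in>A. a \<le> X) \<and> (\<forall>a\<in>A. \<forall>b\<in>A. a \<noteq> b \<longrightarrow> \<not> compat a b)"

definition max_antichain_below :: "'q::order \<Rightarrow> 'q set \<Rightarrow> bool" where
  "max_antichain_below X A \<longleftrightarrow>
     antichain_below X A \<and> (\<forall>B. antichain_below X B \<and> A \<subseteq> B \<longrightarrow> B = A)"

text \<open>In a run of the game of length \<open>\<gamma>\<close>, Cut plays \<open>A \<delta>\<close> and then Choose plays \<open>c \<delta>\<close> in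
  round \<open>\<delta>\<close>. A strategy for Choose maps a round \<open>\<delta>\<close>, the moves of Cut in all rounds up to and
  including \<open>\<delta>\<close>, and the moves of Choose in all rounds before \<open>\<delta>\<close>, to a move of Choose.\<close>

definition Choose_winning_strategy ::
  "'a rel \<Rightarrow> 'q::order \<Rightarrow> ('a \<Rightarrow> ('a \<Rightarrow> 'q set) \<Rightarrow> ('a \<Rightarrow> 'q) \<Rightarrow> 'q) \<Rightarrow> bool" where
  "Choose_winning_strategy \<gamma> X \<sigma> \<longleftrightarrow>
     (\<forall>A c. (\<forall>\<delta>\<in>Field \<gamma>. max_antichain_below X (A \<delta>)) \<and>
            (\<forall>\<delta>\<in>Field \<gamma>. c \<delta> = \<sigma> \<delta> (restrict A (under \<gamma> \<delta>)) (restrict c (underS \<gamma> \<delta>)))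
        \<longrightarrow> (\<forall>\<delta>\<in>Field \<gamma>. c \<delta> \<in> A \<delta>) \<and> (\<exists>q. \<forall>\<delta>\<in>Field \<gamma>. q \<le> c \<delta>))"

definition Choose_wins :: "'q::order \<Rightarrow> 'a rel \<Rightarrow> bool" where
  "Choose_wins X \<gamma> \<longleftrightarrow> (\<exists>\<sigma>. Choose_winning_strategy \<gamma> X \<sigma>)"


section \<open>Strategic closure\<close>

definition immediate_succ :: "'a rel \<Rightarrow> 'a \<Rightarrow> 'a \<Rightarrow> bool" where
  "immediate_succ r a b \<longleftrightarrow> a \<in> underS r b \<and> (\<forall>c\<in>underS r b. (c, a) \<in> r)"

text \<open>The stages without immediate predecessor, which are 0 and the limit stages, are even;
  from there on, the parity alternates.\<close>

inductive even_stage :: "'a rel \<Rightarrow> 'a \<Rightarrow> bool" and odd_stage :: "'a rel \<Rightarrow> 'a \<Rightarrow> bool"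
  for r :: "'a rel" where
  even_zero_limit: "b \<in> Field r \<Longrightarrow> (\<And>a. \<not> immediate_succ r a b) \<Longrightarrow> even_stage r b"
| odd_succ: "even_stage r a \<Longrightarrow> immediate_succ r a b \<Longrightarrow> odd_stage r b"
| even_succ: "odd_stage r a \<Longrightarrow> immediate_succ r a b \<Longrightarrow> even_stage r b"

text \<open>\<open>p\<close> is, on the stages before \<open>\<delta>\<close>, a play of the game in which Even has followed \<open>\<tau>\<close>.
  A strategy for Even receives the current stage and all earlier moves of both players.\<close>

definition Even_position ::
  "'a rel \<Rightarrow> ('a \<Rightarrow> ('a \<Rightarrow> 'q::order) \<Rightarrow> 'q) \<Rightarrow> 'a \<Rightarrow> ('a \<Rightarrow> 'q) \<Rightarrow> bool" where
  "Even_position \<alpha> \<tau> \<delta> p \<longleftrightarrow>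
     (\<forall>\<eta>\<in>underS \<alpha> \<delta>. \<forall>\<xi>\<in>underS \<alpha> \<eta>. p \<eta> \<le> p \<xi>) \<and>
     (\<forall>\<eta>\<in>underS \<alpha> \<delta>. even_stage \<alpha> \<eta> \<longrightarrow> p \<eta> = \<tau> \<eta> (restrict p (underS \<alpha> \<eta>)))"

text \<open>Even wins by being able to move at every even stage below \<open>\<alpha>\<close>, so a strategy is winning
  iff it yields a legal move at every position that is reached by following it. Odd can
  always move, by repeating the previous move of Even.\<close>

definition Even_winning_strategy ::
  "'a rel \<Rightarrow> ('a \<Rightarrow> ('a \<Rightarrow> 'q::order_top) \<Rightarrow> 'q) \<Rightarrow> bool" where
  "Even_winning_strategy \<alpha> \<tau> \<longleftrightarrow>
     (\<forall>\<delta> p. even_stage \<alpha> \<delta> \<and> Even_position \<alpha> \<tau> \<delta> p \<longrightarrow>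
        (underS \<alpha> \<delta> = {} \<longrightarrow> \<tau> \<delta> (restrict p (underS \<alpha> \<delta>)) = top) \<and>
        (\<forall>\<eta>\<in>underS \<alpha> \<delta>. \<tau> \<delta> (restrict p (underS \<alpha> \<delta>)) \<le> p \<eta>))"

definition strategically_closed :: "'q::order_top itself \<Rightarrow> 'a rel \<Rightarrow> bool" where
  "strategically_closed (_ :: 'q itself) \<alpha> \<longleftrightarrow>
     (\<exists>\<tau> :: 'a \<Rightarrow> ('a \<Rightarrow> 'q) \<Rightarrow> 'q. Even_winning_strategy \<alpha> \<tau>)"

text \<open>\<open>cardSuc |Field \<gamma>|\<close> is the least cardinal greater than \<open>\<gamma>\<close>. It lives on the type \<open>'a set\<close>,
  so every ordinal below it is represented by some well-order on that type.\<close>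

definition less_succ_strategically_closed :: "'q::order_top itself \<Rightarrow> 'a rel \<Rightarrow> bool" where
  "less_succ_strategically_closed Q \<gamma> \<longleftrightarrow>
     (\<forall>\<alpha> :: 'a set rel. \<alpha> <o cardSuc |Field \<gamma>| \<longrightarrow> strategically_closed Q \<alpha>)"

end

theory Submission
  imports Defs
begin

text \<open>Both games are compared with an intermediate one, the descent game: its rounds are the
  elements of a set \<open>S\<close> in a well-order, in each round first Even and then Odd extends a
  decreasing sequence that starts below a given \<open>X\<close>, and Even has to be able to move in every
  round and to leave the whole sequence with a lower bound.

  If Choose wins the cut and choose game for all \<open>X\<close>, then Even wins the descent game on every
  set of rounds of \<open>\<gamma>\<close> (\<open>descent_if_Choose_wins\<close>). Even simulates a run in which Choose follows a
  winning strategy and the choices are the moves of Odd. For this Even moves to an element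
  \<open>p\<close> such that every \<open>r \<le> p\<close> is what the strategy picks from some maximal antichain; then
  whatever Odd plays can be turned into a move of Cut. Such a \<open>p\<close> exists: otherwise the
  elements that are never picked are dense, so Cut could play a maximal antichain consisting
  of them. That \<open>p\<close> can be taken below all earlier moves at limit rounds uses a distributivity
  property of the poset, which again follows from Choose winning (\<open>decide_lower_bound\<close>).

  The descent game on \<open>\<gamma>\<close> yields the one on any well-order \<open>\<alpha>\<close> with at most \<open>|\<gamma>|\<close> elements
  (\<open>descent_any_length\<close>). Choose a map \<open>f\<close> from \<open>\<gamma>\<close> onto \<open>\<alpha>\<close>. The indices at which \<open>f\<close> takes a
  value larger than all previous ones form a subset \<open>R\<close> of \<open>\<gamma>\<close>, and the values at these indices
  are cofinal in \<open>\<alpha>\<close>. They cut \<open>\<alpha>\<close> into blocks, one for each element of \<open>R\<close> and each bounded in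
  \<open>\<alpha>\<close>. By induction Even wins inside the blocks, and a strategy for \<open>R\<close>, consulted once per
  block, glues these games together (\<open>descent_concat\<close>). Hence Even wins the official game of
  every length below \<open>|\<gamma>|\<^sup>+\<close>, where the descent game is played at the even stages.

  Conversely, given a strategy of Even for a sufficiently long game, Choose runs it against an
  Odd who in the stage assigned to round \<open>\<delta>\<close> moves below some element of the antichain of that
  round; Choose picks this element (\<open>Choose_wins_if_Even_wins\<close>). A further move of Even after
  all these stages is a lower bound of the choices. As the successor cardinal of \<open>|\<gamma>|\<close> is
  regular, some length below it has room for \<open>\<gamma>\<close> many increasing odd stages and an even stage
  above them (\<open>odd_stage_embedding\<close>).\<close>


section \<open>Well-orders and recursion along them\<close>

lemma underS_trans:
  assumes "Well_order r" "a \<in> underS r b" "b \<in> underS r c"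
  shows "a \<in> underS r c"
proof -
  have "trans r" "antisym r"
    using assms(1) by (auto simp: order_on_defs)
  then show ?thesis
    using assms(2,3) by (auto simp: underS_def dest: transD antisymD)
qed

lemma underS_irrefl: "a \<notin> underS r a"
  by (simp add: underS_def)

lemma underS_Field: "a \<in> underS r b \<Longrightarrow> a \<in> Field r" "a \<in> underS r b \<Longrightarrow> b \<in> Field r"
  by (auto simp: underS_def Field_def)

lemma underS_trichotomy:
  assumes "Well_order r" "a \<in> Field r" "b \<in> Field r"
  obtains "a \<in> underS r b" | "a = b" | "b \<in> underS r a"
proof -
  have "total_on (Field r) r"
    using assms(1) by (auto simp: order_on_defs)
  then show thesis
    using that assms(2,3) by (auto simp: underS_def total_on_def)
qed

lemma under_eq: "Well_order r \<Longrightarrow> a \<in> Field r \<Longrightarrow> under r a = insert a (underS r a)"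
  by (auto simp: under_def underS_def order_on_defs refl_on_def)

lemma Well_order_wf: "Well_order r \<Longrightarrow> wf (r - Id)"
  by (simp add: well_order_on_def)

lemma Well_order_induct [consumes 1, case_names less]:
  assumes "Well_order r" "\<And>x. (\<And>y. y \<in> underS r x \<Longrightarrow> P y) \<Longrightarrow> P x"
  shows "P x"
  using Well_order_wf[OF assms(1)]
  by (induction x rule: wf_induct_rule) (auto simp: underS_def intro: assms(2))

lemma Well_order_least:
  assumes "Well_order r" "A \<subseteq> Field r" "A \<noteq> {}"
  obtains m where "m \<in> A" "\<forall>a\<in>A. a = m \<or> m \<in> underS r a"
proof -
  obtain m where m: "m \<in> A" "\<And>y. (y, m) \<in> r - Id \<Longrightarrow> y \<notin> A"
    using wfE_min[OF Well_order_wf[OF assms(1)]] assms(3) by (metis ex_in_conv)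
  have "\<forall>a\<in>A. a = m \<or> m \<in> underS r a"
  proof
    show "a = m \<or> m \<in> underS r a" if "a \<in> A" for a
      using underS_trichotomy[OF assms(1), of a m] m that assms(2)
      by (auto simp: underS_def)
  qed
  with m(1) show thesis
    by (rule that)
qed

text \<open>The recursion combinator is phrased with \<^const>\<open>restrict\<close>, so that a function defined by
  it satisfies literally the kind of equation by which a player follows a strategy.\<close>

definition worec :: "'a rel \<Rightarrow> ('a \<Rightarrow> ('a \<Rightarrow> 'b) \<Rightarrow> 'b) \<Rightarrow> 'a \<Rightarrow> 'b" where
  "worec r G = wfrec (r - Id) (\<lambda>f x. G x (restrict f (underS r x)))"

lemma worec:
  assumes "Well_order r"
  shows "worec r G x = G x (restrict (worec r G) (underS r x))"
proof -
  have "restrict (cut f (r - Id) x) (underS r x) = restrict f (underS r x)" for f :: "'a \<Rightarrow> 'b"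
    by (auto simp: fun_eq_iff cut_def underS_def)
  then show ?thesis
    unfolding worec_def by (subst wfrec[OF Well_order_wf[OF assms]]) simp
qed

text \<open>This is how a move that is computed from a simulated run is seen to depend on the past only, as a
  strategy demands.\<close>

lemma worec_cong:
  assumes "Well_order r" "\<And>y f. y = x \<or> y \<in> underS r x \<Longrightarrow> G y f = G' y f"
  shows "worec r G x = worec r G' x"
  using assms
proof (induction x rule: Well_order_induct)
  case (less x)
  have "restrict (worec r G) (underS r x) = restrict (worec r G') (underS r x)"
    using less.IH less.prems underS_trans[OF assms(1)] by (intro restrict_ext) metis
  then show ?case
    using worec[OF assms(1), of G x] worec[OF assms(1), of G' x] less.prems[of x] by metis
qed


section \<open>Parity of stages\<close>

lemma immediate_succ_Field: "immediate_succ r a b \<Longrightarrow> a \<in> Field r" "immediate_succ r a b \<Longrightarrow> b \<in> Field r"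
  by (auto simp: immediate_succ_def dest: underS_Field)

lemma immediate_succ_inj:
  assumes "Well_order r" "immediate_succ r a b" "immediate_succ r a' b"
  shows "a = a'"
proof -
  have "antisym r"
    using assms(1) by (auto simp: order_on_defs)
  then show ?thesis
    using assms(2,3) by (auto simp: immediate_succ_def dest: antisymD)
qed

lemma immediate_succ_fun:
  assumes "Well_order r" "immediate_succ r a b" "immediate_succ r a b'"
  shows "b = b'"
proof -
  have *: False if "immediate_succ r a x" "immediate_succ r a y" "x \<in> underS r y" for x y
  proof -
    have "(x, a) \<in> r" "a \<in> underS r x"
      using that by (auto simp: immediate_succ_def)
    moreover have "antisym r"
      using assms(1) by (auto simp: order_on_defs)
    ultimately show False
      by (auto simp: underS_def dest: antisymD)
  qed
  show ?thesis
    using underS_trichotomy[OF assms(1) immediate_succ_Field(2)[OF assms(2)]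
        immediate_succ_Field(2)[OF assms(3)]] * assms(2,3) by metis
qed

lemma underS_immediate_succ:
  assumes "Well_order r" "immediate_succ r a b" "c \<in> underS r b"
  shows "c = a \<or> c \<in> underS r a"
  using assms(2,3) by (auto simp: immediate_succ_def underS_def)

lemma immediate_succ_exists:
  assumes "Well_order r" "a \<in> underS r b"
  obtains c where "immediate_succ r a c" "c = b \<or> c \<in> underS r b"
proof -
  let ?A = "{c. a \<in> underS r c}"
  have A: "?A \<subseteq> Field r" "?A \<noteq> {}"
    using assms(2) by (auto dest: underS_Field)
  obtain c where c: "c \<in> ?A" "\<forall>d\<in>?A. d = c \<or> c \<in> underS r d"
    by (rule Well_order_least[OF assms(1) A])
  have "(d, a) \<in> r" if "d \<in> underS r c" for d
  proof -
    have "a \<notin> underS r d"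
      using c(2) that underS_trans[OF assms(1), of d c d] underS_irrefl[of d r] by auto
    then have "d \<in> under r a"
      using underS_trichotomy[OF assms(1), of a d] under_eq[OF assms(1), of a]
        underS_Field(1)[OF assms(2)] underS_Field(1)[OF that] by auto
    then show ?thesis
      by (simp add: under_def)
  qed
  with c(1) have "immediate_succ r a c"
    by (simp add: immediate_succ_def)
  moreover have "c = b \<or> c \<in> underS r b"
    using c(2) assms(2) by auto
  ultimately show thesis
    by (rule that)
qed

lemma even_stage_Field: "even_stage r b \<Longrightarrow> b \<in> Field r"
  by (auto elim: even_stage.cases dest: immediate_succ_Field)

lemma odd_stage_Field: "odd_stage r b \<Longrightarrow> b \<in> Field r"
  by (auto elim: odd_stage.cases dest: immediate_succ_Field)

lemma even_or_odd_stage: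
  assumes "Well_order r" "b \<in> Field r"
  shows "even_stage r b \<or> odd_stage r b"
  using assms
proof (induction b rule: Well_order_induct)
  case (less b)
  show ?case
  proof (cases "\<exists>a. immediate_succ r a b")
    case True
    then obtain a where a: "immediate_succ r a b" "a \<in> underS r b"
      by (auto simp: immediate_succ_def)
    then have "even_stage r a \<or> odd_stage r a"
      using less.IH underS_Field by metis
    then show ?thesis
      using a(1) odd_succ even_succ by metis
  next
    case False
    then show ?thesis
      using less.prems even_zero_limit by metis
  qed
qed

text \<open>The two parities of a common stage would be inherited from its only immediate predecessor, and
  so descend forever.\<close>

lemma not_even_and_odd_stage:
  assumes "Well_order r" "even_stage r b" "odd_stage r b"
  shows False
  using assms
proof (induction b rule: Well_order_induct)
  case (less b)
  obtain a where a: "even_stage r a" "immediate_succ r a b"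
    using less.prems(2) by (cases rule: odd_stage.cases)
  then obtain a' where a': "odd_stage r a'" "immediate_succ r a' b"
    using less.prems(1) by (auto elim: even_stage.cases)
  then have "a' = a"
    using immediate_succ_inj[OF assms(1)] a by metis
  then show False
    using less.IH[of a] a a' by (auto simp: immediate_succ_def)
qed

text \<open>Odd moves are cofinal below every even stage: an earlier even stage \<open>a\<close> has a successor,
  which is odd and hence different from the even stage it could at most be equal to.\<close>

lemma odd_stages_cofinal_below_even:
  assumes "Well_order r" "even_stage r b" "a \<in> underS r b"
  obtains x y where "even_stage r x" "immediate_succ r x y" "y \<in> underS r b" "a = x \<or> a = y"
proof (cases "even_stage r a")
  case True
  obtain y where y: "immediate_succ r a y" "y = b \<or> y \<in> underS r b"
    by (rule immediate_succ_exists[OF assms(1,3)])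
  then have "odd_stage r y"
    using True odd_succ by metis
  then have "y \<in> underS r b"
    using y(2) assms(2) not_even_and_odd_stage[OF assms(1)] by metis
  then show thesis
    using that True y(1) by metis
next
  case False
  then have "odd_stage r a"
    using even_or_odd_stage[OF assms(1) underS_Field(1)[OF assms(3)]] by simp
  then obtain x where "even_stage r x" "immediate_succ r x a"
    by (cases rule: odd_stage.cases)
  then show thesis
    using that assms(3) by metis
qed

lemma underS_Restr_underS:
  assumes "Well_order r" "b \<in> underS r t"
  shows "underS (Restr r (underS r t)) b = underS r b"
proof -
  have "c \<in> underS r t" if "c \<in> underS r b" for c
    using that assms underS_trans by metis
  then show ?thesis
    using assms(2) by (auto simp: underS_def)
qed

lemma immediate_succ_Restr_underS:
  assumes "Well_order r" "b \<in> underS r t"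
  shows "immediate_succ (Restr r (underS r t)) a b \<longleftrightarrow> immediate_succ r a b"
proof -
  have "underS r b \<subseteq> underS r t"
    using assms underS_trans by fast
  then show ?thesis
    by (auto simp: immediate_succ_def underS_Restr_underS[OF assms])
qed

text \<open>Parity is determined by the earlier stages, so it is the same in an initial segment.\<close>

lemma parity_Restr_underS:
  assumes "Well_order r" "b \<in> underS r t"
  shows "(even_stage r b \<longrightarrow> even_stage (Restr r (underS r t)) b) \<and>
         (odd_stage r b \<longrightarrow> odd_stage (Restr r (underS r t)) b)"
  using assms
proof (induction b rule: Well_order_induct)
  case (less b)
  let ?s = "Restr r (underS r t)"
  note succ = immediate_succ_Restr_underS[OF assms(1) less.prems]
  have IH: "(even_stage r a \<longrightarrow> even_stage ?s a) \<and> (odd_stage r a \<longrightarrow> odd_stage ?s a)"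
    if "immediate_succ r a b" for a
    using that less.IH[of a] less.prems underS_trans[OF assms(1)]
    by (auto simp: immediate_succ_def)
  have "(b, b) \<in> r"
    using assms(1) underS_Field(1)[OF less.prems] by (auto simp: order_on_defs refl_on_def)
  then have b: "b \<in> Field ?s"
    using less.prems by (auto simp: Field_def)
  show ?case
  proof (intro conjI impI)
    assume "even_stage r b"
    then show "even_stage ?s b"
    proof (cases rule: even_stage.cases)
      case even_zero_limit
      then show ?thesis
        using b succ even_stage_odd_stage.even_zero_limit by metis
    next
      case (even_succ a)
      then show ?thesis
        using IH succ even_stage_odd_stage.even_succ by metis
    qed
  next
    assume "odd_stage r b"
    then show "odd_stage ?s b"
    proof (cases rule: odd_stage.cases)
      case (odd_succ a)
      then show ?thesis
        using IH succ even_stage_odd_stage.odd_succ by metis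
    qed
  qed
qed


section \<open>The descent game\<close>

text \<open>Round \<open>x\<close> of the descent game consists of a move \<open>\<tau> x q\<close> of Even followed by a move \<open>q x\<close>
  of Odd. A strategy for Even is a function of the moves of Odd alone, since these determine
  the moves of Even. This makes it possible to combine strategies without
  recursion.\<close>

definition obeys :: "('a \<Rightarrow> ('a \<Rightarrow> 'q::order) \<Rightarrow> 'q) \<Rightarrow> 'a set \<Rightarrow> ('a \<Rightarrow> 'q) \<Rightarrow> bool" where
  "obeys \<tau> D q \<longleftrightarrow> (\<forall>x\<in>D. q x \<le> \<tau> x q)"

text \<open>The rounds are an arbitrary set of elements of a well-order, so that subsets of a
  well-order are games in the same sense, and the starting point \<open>X\<close> is a parameter, so that a
  game can be continued from any position by another one.\<close>

definition descent_strategy ::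
  "'a rel \<Rightarrow> 'a set \<Rightarrow> 'q::order \<Rightarrow> ('a \<Rightarrow> ('a \<Rightarrow> 'q) \<Rightarrow> 'q) \<Rightarrow> bool" where
  "descent_strategy r S X \<tau> \<longleftrightarrow>
     (\<forall>x\<in>S. \<forall>q q'. (\<forall>y\<in>S \<inter> underS r x. q y = q' y) \<longrightarrow> \<tau> x q = \<tau> x q') \<and>
     (\<forall>x\<in>S. \<forall>q. obeys \<tau> (S \<inter> underS r x) q \<longrightarrow>
        \<tau> x q \<le> X \<and> (\<forall>y\<in>S \<inter> underS r x. \<tau> x q \<le> q y)) \<and>
     (\<forall>q. obeys \<tau> S q \<longrightarrow> (\<exists>b\<le>X. \<forall>y\<in>S. b \<le> q y))"

lemma descent_strategyD:
  assumes "descent_strategy r S X \<tau>"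
  shows "\<And>x q q'. x \<in> S \<Longrightarrow> (\<And>y. y \<in> S \<Longrightarrow> y \<in> underS r x \<Longrightarrow> q y = q' y) \<Longrightarrow> \<tau> x q = \<tau> x q'"
    and "\<And>x q. x \<in> S \<Longrightarrow> obeys \<tau> (S \<inter> underS r x) q \<Longrightarrow> \<tau> x q \<le> X"
    and "\<And>x y q. x \<in> S \<Longrightarrow> obeys \<tau> (S \<inter> underS r x) q \<Longrightarrow> y \<in> S \<Longrightarrow> y \<in> underS r x \<Longrightarrow> \<tau> x q \<le> q y"
    and "\<And>q. obeys \<tau> S q \<Longrightarrow> \<exists>b\<le>X. \<forall>y\<in>S. b \<le> q y"
  using assms unfolding descent_strategy_def by (blast, blast, blast, blast)

lemma descent_strategyI:
  assumes "\<And>x q q'. x \<in> S \<Longrightarrow> (\<And>y. y \<in> S \<Longrightarrow> y \<in> underS r x \<Longrightarrow> q y = q' y) \<Longrightarrow> \<tau> x q = \<tau> x q'"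
    and "\<And>x q. x \<in> S \<Longrightarrow> obeys \<tau> (S \<inter> underS r x) q \<Longrightarrow> \<tau> x q \<le> X"
    and "\<And>x y q. x \<in> S \<Longrightarrow> obeys \<tau> (S \<inter> underS r x) q \<Longrightarrow> y \<in> S \<Longrightarrow> y \<in> underS r x \<Longrightarrow> \<tau> x q \<le> q y"
    and "\<And>q. obeys \<tau> S q \<Longrightarrow> \<exists>b\<le>X. \<forall>y\<in>S. b \<le> q y"
  shows "descent_strategy r S X \<tau>"
  using assms unfolding descent_strategy_def by blast

lemma obeysD: "obeys \<tau> D q \<Longrightarrow> x \<in> D \<Longrightarrow> q x \<le> \<tau> x q"
  by (simp add: obeys_def)

text \<open>The rounds \<open>S\<close> are divided into consecutive blocks indexed by \<open>R\<close>; \<open>g x\<close> is the block of \<open>x\<close>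
  and \<open>f i\<close> is the last round of block \<open>i\<close>. The main game, whose rounds are the blocks, sees
  only the moves of Odd in the rounds \<open>f i\<close>. The move of its strategy in round \<open>i\<close> serves as
  the starting point of a game on the rest of block \<open>i\<close>, whose strategy guarantees that at
  \<open>f i\<close> a lower bound of the block is left for Even to play. Everything in later
  blocks happens below the move of Odd at \<open>f i\<close>, which is why the order between different
  blocks takes care of itself, limits of blocks included.\<close>

lemma descent_concat:
  fixes r :: "'a rel" and s :: "'g rel" and S :: "'a set" and R :: "'g set" and X :: "'q::order"
  assumes r: "Well_order r" and s: "Well_order s" and S: "S \<subseteq> Field r" and R: "R \<subseteq> Field s"
    and gR: "\<And>x. x \<in> S \<Longrightarrow> g x \<in> R" and fS: "\<And>i. i \<in> R \<Longrightarrow> f i \<in> S"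
    and gf: "\<And>i. i \<in> R \<Longrightarrow> g (f i) = i"
    and fmax: "\<And>x. x \<in> S \<Longrightarrow> x = f (g x) \<or> x \<in> underS r (f (g x))"
    and gmono: "\<And>x y. x \<in> S \<Longrightarrow> y \<in> S \<Longrightarrow> y \<in> underS r x \<Longrightarrow> g y = g x \<or> g y \<in> underS s (g x)"
    and main: "\<And>X :: 'q. \<exists>\<tau>. descent_strategy s R X \<tau>"
    and block: "\<And>i (X :: 'q). i \<in> R \<Longrightarrow> \<exists>\<tau>. descent_strategy r {x \<in> S. g x = i \<and> x \<noteq> f i} X \<tau>"
  shows "\<exists>\<tau>. descent_strategy r S X \<tau>"
proof -
  define B where "B i = {x \<in> S. g x = i \<and> x \<noteq> f i}" for i
  obtain M where M: "descent_strategy s R X M"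
    using main by blast
  have "\<forall>i P. i \<in> R \<longrightarrow> (\<exists>\<tau>. descent_strategy r (B i) (P :: 'q) \<tau>)"
    using block by (simp add: B_def)
  then obtain T where T: "\<And>i P. i \<in> R \<Longrightarrow> descent_strategy r (B i) (P :: 'q) (T i P)"
    by metis
  \<comment> \<open>The last round of block \<open>i\<close> at the same time serves as round \<open>i\<close> of the main game. The
     move of the main strategy in round \<open>i\<close> is the starting point of block \<open>i\<close>.\<close>
  define start where "start i q = M i (\<lambda>j. q (f j))" for i and q :: "'a \<Rightarrow> 'q"
  define stop where "stop i q = (SOME b. b \<le> start i q \<and> (\<forall>y\<in>B i. b \<le> q y))"
    for i and q :: "'a \<Rightarrow> 'q"
  define \<tau> where "\<tau> x q = (if x = f (g x) then stop (g x) q else T (g x) (start (g x) q) x q)"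
    for x and q :: "'a \<Rightarrow> 'q"
  have f_last: "f i \<in> underS r x" if "x \<in> S" "i \<in> R" "i \<in> underS s (g x)" for x i
    using underS_trichotomy[OF r, of "f i" x] that fS[OF that(2)] S gmono[of "f i" x] gf[OF that(2)]
      underS_trans[OF s, of i "g x" i] underS_irrefl[of i s] by (metis subsetD)
  have f_mono: "f j \<in> underS r (f i)" if "j \<in> R" "i \<in> R" "j \<in> underS s i" for i j
    using f_last[of "f i" j] that fS gf by metis
  have B_below: "y \<in> underS r (f i)" if "y \<in> B i" for i y
    using that fmax[of y] by (auto simp: B_def)
  have B_g: "y \<in> S" "g y = i" if "y \<in> B i" for i y
    using that by (auto simp: B_def)
  have \<tau>_f: "\<tau> (f i) q = stop i q" if "i \<in> R" for i q
    using gf[OF that] by (simp add: \<tau>_def)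
  have \<tau>_B: "\<tau> x q = T i (start i q) x q" if "x \<in> B i" for x i q
    using that by (auto simp: \<tau>_def B_def)
  have cases: "x \<in> B (g x) \<or> x = f (g x)" if "x \<in> S" for x
    using that by (auto simp: B_def)
  have start_cong: "start i q = start i q'"
    if "i \<in> R" "\<And>j. j \<in> R \<Longrightarrow> j \<in> underS s i \<Longrightarrow> q (f j) = q' (f j)" for i q q'
    unfolding start_def by (rule descent_strategyD(1)[OF M that(1)]) (rule that(2))
  have stop: "stop i q \<le> start i q" "\<And>y. y \<in> B i \<Longrightarrow> stop i q \<le> q y"
    if "i \<in> R" "obeys \<tau> (B i) q" for i q
  proof -
    have "obeys (T i (start i q)) (B i) q"
      using that(2) by (simp add: obeys_def \<tau>_B)
    then have "\<exists>b. b \<le> start i q \<and> (\<forall>y\<in>B i. b \<le> q y)"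
      using descent_strategyD(4)[OF T[OF that(1)]] by blast
    then have "stop i q \<le> start i q \<and> (\<forall>y\<in>B i. stop i q \<le> q y)"
      unfolding stop_def by (rule someI_ex)
    then show "stop i q \<le> start i q" "\<And>y. y \<in> B i \<Longrightarrow> stop i q \<le> q y"
      by auto
  qed
  have main_obeys: "obeys M D (\<lambda>j. q (f j))"
    if "D \<subseteq> R" "\<And>x. x \<in> S \<Longrightarrow> g x \<in> D \<Longrightarrow> q x \<le> \<tau> x q" for D q
    unfolding obeys_def
  proof
    fix j assume j: "j \<in> D"
    then have "q (f j) \<le> stop j q"
      using that(2)[of "f j"] that(1) fS gf \<tau>_f by (metis subsetD)
    also have "obeys \<tau> (B j) q"
      using that(2) j by (auto simp: obeys_def B_def)
    then have "stop j q \<le> start j q"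
      using stop(1) j that(1) by blast
    finally show "q (f j) \<le> M j (\<lambda>j. q (f j))"
      by (simp add: start_def)
  qed
  have past: "q (f (g y)) \<le> q y" if "y \<in> S" "\<And>x. x \<in> S \<Longrightarrow> g x = g y \<Longrightarrow> q x \<le> \<tau> x q" for y q
  proof (cases "y = f (g y)")
    case False
    have "q (f (g y)) \<le> stop (g y) q"
      using that(2)[of "f (g y)"] \<tau>_f gR[OF that(1)] fS gf by metis
    also have "obeys \<tau> (B (g y)) q"
      using that(2) by (auto simp: obeys_def B_def)
    then have "stop (g y) q \<le> q y"
      using stop(2)[OF gR[OF that(1)]] cases[OF that(1)] False by blast
    finally show ?thesis .
  qed simp
  have step: "\<tau> x q \<le> X \<and> (\<forall>y\<in>S \<inter> underS r x. \<tau> x q \<le> q y)"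
    if x: "x \<in> S" and q: "obeys \<tau> (S \<inter> underS r x) q" for x q
  proof -
    let ?i = "g x"
    have i: "?i \<in> R"
      by (rule gR[OF x])
    have earlier: "q y \<le> \<tau> y q" if "y \<in> S" "y \<in> underS r x" for y
      using obeysD[OF q] that by blast
    have earlier_block: "q y \<le> \<tau> y q" if "y \<in> S" "g y \<in> underS s ?i" for y
    proof (rule earlier[OF that(1)])
      show "y \<in> underS r x"
        using f_last[OF x gR[OF that(1)] that(2)] fmax[OF that(1)] underS_trans[OF r] by metis
    qed
    have M_ob: "obeys M (R \<inter> underS s ?i) (\<lambda>j. q (f j))"
      by (rule main_obeys) (auto intro: earlier_block)
    have start: "start ?i q \<le> X" "\<And>j. j \<in> R \<Longrightarrow> j \<in> underS s ?i \<Longrightarrow> start ?i q \<le> q (f j)"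
      unfolding start_def using descent_strategyD(2,3)[OF M i M_ob] by auto
    have now: "\<tau> x q \<le> start ?i q \<and> (\<forall>y\<in>B ?i \<inter> underS r x. \<tau> x q \<le> q y)"
    proof (cases "x = f ?i")
      case True
      have "obeys \<tau> (B ?i) q"
        using earlier B_below B_g(1) True by (metis obeys_def)
      then show ?thesis
        using stop[OF i] \<tau>_f[OF i] True by auto
    next
      case False
      then have xB: "x \<in> B ?i"
        using cases[OF x] by blast
      have "obeys (T ?i (start ?i q)) (B ?i \<inter> underS r x) q"
        using earlier B_g(1) \<tau>_B by (metis obeys_def IntD1 IntD2)
      then show ?thesis
        using descent_strategyD(2,3)[OF T[OF i] xB] \<tau>_B[OF xB] by auto
    qed
    have "\<tau> x q \<le> q y" if y: "y \<in> S" "y \<in> underS r x" for y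
    proof (cases "g y = ?i")
      case True
      have "y \<noteq> f ?i"
        using y(2) fmax[OF x] underS_trans[OF r, of y x y] underS_irrefl[of y r] by metis
      then have "y \<in> B ?i"
        using y True by (simp add: B_def)
      then show ?thesis
        using now y by blast
    next
      case False
      then have gy: "g y \<in> underS s ?i"
        using gmono[OF x y] by blast
      have "\<tau> x q \<le> start ?i q"
        using now by blast
      also have "\<dots> \<le> q (f (g y))"
        by (rule start(2)[OF gR[OF y(1)] gy])
      also have "\<dots> \<le> q y"
        using past[OF y(1)] earlier_block gy by metis
      finally show ?thesis .
    qed
    moreover have "\<tau> x q \<le> X"
      using now start(1) order_trans by blast
    ultimately show ?thesis
      by blast
  qed
  have "descent_strategy r S X \<tau>"
  proof (rule descent_strategyI)
    fix x q q' assume x: "x \<in> S" and eq: "\<And>y. y \<in> S \<Longrightarrow> y \<in> underS r x \<Longrightarrow> q y = (q' y :: 'q)"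
    let ?i = "g x"
    have i: "?i \<in> R"
      by (rule gR[OF x])
    have st: "start ?i q = start ?i q'"
      by (rule start_cong[OF i]) (rule eq[OF fS f_last[OF x]])
    show "\<tau> x q = \<tau> x q'"
    proof (cases "x = f ?i")
      case True
      have "\<And>y. y \<in> B ?i \<Longrightarrow> q y = q' y"
        using eq B_g(1) B_below True by metis
      then have "stop ?i q = stop ?i q'"
        unfolding stop_def st by auto
      then show ?thesis
        using True by (simp add: \<tau>_def)
    next
      case False
      then have xB: "x \<in> B ?i"
        using cases[OF x] by blast
      show ?thesis
        unfolding \<tau>_B[OF xB] st
        by (rule descent_strategyD(1)[OF T[OF i] xB]) (rule eq[OF B_g(1)])
    qed
  next
    fix q assume q: "obeys \<tau> S q"
    have "obeys M R (\<lambda>j. q (f j))"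
      by (rule main_obeys) (auto intro: obeysD[OF q])
    then obtain b where b: "b \<le> X" "\<And>i. i \<in> R \<Longrightarrow> b \<le> q (f i)"
      using descent_strategyD(4)[OF M] by blast
    have "b \<le> q y" if y: "y \<in> S" for y
      using b(2)[OF gR[OF y]] past[OF y] obeysD[OF q] order_trans by blast
    with b(1) show "\<exists>b\<le>X. \<forall>y\<in>S. b \<le> q y"
      by blast
  qed (use step in auto)
  then show ?thesis
    by blast
qed

text \<open>The blocks for the concatenation come from a map \<open>f\<close> of \<open>s\<close> onto \<open>S\<close>: the set \<open>R\<close> consists of
  the indices at which \<open>f\<close> exceeds all its earlier values, and \<open>x\<close> belongs to the block of the
  first \<open>i\<close> with \<open>x \<le> f i\<close>, which necessarily lies in \<open>R\<close>. So every set with at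
  most as many elements as \<open>s\<close> is a sum of bounded pieces along a subset of \<open>s\<close>, without any
  appeal to cofinalities.\<close>

lemma descent_step:
  fixes r :: "'a rel" and s :: "'g rel" and X :: "'q::order"
  assumes r: "Well_order r" and s: "Well_order s" and S: "S \<subseteq> Field r" "|S| \<le>o |Field s|"
    and main: "\<And>R (X :: 'q). R \<subseteq> Field s \<Longrightarrow> \<exists>\<tau>. descent_strategy s R X \<tau>"
    and IH: "\<And>x B (X :: 'q). x \<in> S \<Longrightarrow> B \<subseteq> S \<inter> underS r x \<Longrightarrow> \<exists>\<tau>. descent_strategy r B X \<tau>"
  shows "\<exists>\<tau>. descent_strategy r S X \<tau>"
proof (cases "S = {}")
  case True
  then show ?thesis
    by (auto simp: descent_strategy_def)
next
  case False
  then obtain f where f: "f ` Field s = S"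
    using card_of_ordLeq2[OF False, of "Field s"] S(2) by auto
  have fS: "f i \<in> S" if "i \<in> Field s" for i
    using f that by blast
  define R where "R = {i \<in> Field s. \<forall>j\<in>underS s i. f j \<in> underS r (f i)}"
  have "\<exists>i\<in>Field s. (x = f i \<or> x \<in> underS r (f i)) \<and>
      (\<forall>j\<in>Field s. x = f j \<or> x \<in> underS r (f j) \<longrightarrow> j = i \<or> i \<in> underS s j)"
    if "x \<in> S" for x
  proof -
    let ?A = "{i \<in> Field s. x = f i \<or> x \<in> underS r (f i)}"
    have A: "?A \<subseteq> Field s" "?A \<noteq> {}"
      using f that by auto
    obtain i where "i \<in> ?A" "\<forall>j\<in>?A. j = i \<or> i \<in> underS s j"
      by (rule Well_order_least[OF s A])
    then show ?thesis
      by blast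
  qed
  then obtain g where g: "\<And>x. x \<in> S \<Longrightarrow> g x \<in> Field s"
      "\<And>x. x \<in> S \<Longrightarrow> x = f (g x) \<or> x \<in> underS r (f (g x))"
      "\<And>x j. x \<in> S \<Longrightarrow> j \<in> Field s \<Longrightarrow> x = f j \<or> x \<in> underS r (f j) \<Longrightarrow> j = g x \<or> g x \<in> underS s j"
    by metis
  have g_least: "f j \<in> underS r x" if "x \<in> S" "j \<in> underS s (g x)" for x j
  proof -
    have j: "j \<in> Field s" "\<not> (j = g x \<or> g x \<in> underS s j)"
      using that(2) underS_Field(1)[OF that(2)] underS_trans[OF s, of j "g x" j] underS_irrefl[of j s]
      by auto
    then show ?thesis
      using g(3)[OF that(1) j(1)] underS_trichotomy[OF r, of "f j" x] fS[OF j(1)] S(1) that(1)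
      by blast
  qed
  show ?thesis
  proof (rule descent_concat[OF r s S(1), where f = f and g = g and R = R])
    show "R \<subseteq> Field s"
      by (auto simp: R_def)
    show "g x \<in> R" if x: "x \<in> S" for x
      using g(1,2)[OF x] g_least[OF x] underS_trans[OF r] by (auto simp: R_def)
    show "f i \<in> S" if "i \<in> R" for i
      using fS that by (simp add: R_def)
    show "g (f i) = i" if "i \<in> R" for i
    proof -
      have i: "i \<in> Field s" "\<And>j. j \<in> underS s i \<Longrightarrow> f j \<in> underS r (f i)"
        using that by (auto simp: R_def)
      have False if "g (f i) \<in> underS s i"
        using i(2)[OF that] g(2)[OF fS[OF i(1)]] underS_trans[OF r] underS_irrefl by metis
      then show ?thesis
        using g(3)[OF fS[OF i(1)] i(1)] by metis
    qed
    show "x = f (g x) \<or> x \<in> underS r (f (g x))" if "x \<in> S" for x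
      by (rule g(2)[OF that])
    show "g y = g x \<or> g y \<in> underS s (g x)" if "x \<in> S" "y \<in> S" "y \<in> underS r x" for x y
    proof -
      have "y \<in> underS r (f (g x))"
        using g(2)[OF that(1)] that(3) underS_trans[OF r] by metis
      then show ?thesis
        using g(3)[OF that(2) g(1)[OF that(1)]] by auto
    qed
    show "\<exists>\<tau>. descent_strategy s R X \<tau>" for X :: 'q
      by (rule main) (auto simp: R_def)
    show "\<exists>\<tau>. descent_strategy r {x \<in> S. g x = i \<and> x \<noteq> f i} X \<tau>" if "i \<in> R" for i and X :: 'q
    proof (rule IH)
      show "f i \<in> S"
        using fS that by (simp add: R_def)
      show "{x \<in> S. g x = i \<and> x \<noteq> f i} \<subseteq> S \<inter> underS r (f i)"
        using g(2) by blast
    qed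
  qed
qed

text \<open>The induction covers all subsets of initial segments, since the blocks arising in the step are
  such subsets but need not be initial segments themselves.\<close>

lemma descent_any_length:
  fixes r :: "'a rel" and s :: "'g rel" and X :: "'q::order"
  assumes r: "Well_order r" and s: "Well_order s" and rs: "|Field r| \<le>o |Field s|"
    and main: "\<And>R (X :: 'q). R \<subseteq> Field s \<Longrightarrow> \<exists>\<tau>. descent_strategy s R X \<tau>"
    and S: "S \<subseteq> Field r"
  shows "\<exists>\<tau>. descent_strategy r S X \<tau>"
proof -
  have small: "|T| \<le>o |Field s|" if "T \<subseteq> Field r" for T
    using card_of_mono1[OF that] rs ordLeq_transitive by blast
  have *: "\<exists>\<tau>. descent_strategy r T X \<tau>" if "T \<subseteq> underS r x" for x T and X :: 'q
    using r that
  proof (induction x arbitrary: T X rule: Well_order_induct)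
    case (less x)
    then have T: "T \<subseteq> Field r"
      using underS_Field(1) by fast
    show ?case
    proof (rule descent_step[OF r s T small[OF T] main])
      show "\<exists>\<tau>. descent_strategy r B X \<tau>" if "y \<in> T" "B \<subseteq> T \<inter> underS r y" for y B and X :: 'q
        using less.IH[of y B X] less.prems that by blast
    qed
  qed
  show ?thesis
  proof (rule descent_step[OF r s S small[OF S] main])
    show "\<exists>\<tau>. descent_strategy r B X \<tau>" if "y \<in> S" "B \<subseteq> S \<inter> underS r y" for y B and X :: 'q
      using *[of B y X] that by blast
  qed
qed


section \<open>From the descent game to strategic closure\<close>

text \<open>The rounds of the descent game are the nonzero even stages, where the answer of Odd comes at
  the following odd stage. Stage 0 is excluded because Even has to play the top element there;
  the move of Odd at stage 1 becomes the starting point \<open>X\<close>. Since odd stages are cofinal below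
  even ones, a lower bound of all moves of Odd is a lower bound of all moves.\<close>

lemma strategically_closed_if_descent:
  fixes r :: "'a rel"
  assumes r: "Well_order r"
    and descent: "\<And>S (X :: 'q::order_top). S \<subseteq> Field r \<Longrightarrow> \<exists>\<tau>. descent_strategy r S X \<tau>"
  shows "strategically_closed TYPE('q) r"
proof -
  define S where "S = {x. even_stage r x \<and> underS r x \<noteq> {}}"
  have "S \<subseteq> Field r"
    by (auto simp: S_def dest: even_stage_Field)
  then obtain T where T: "\<And>X :: 'q. descent_strategy r S X (T X)"
    using descent by metis
  define nxt where "nxt x = (SOME y. immediate_succ r x y)" for x
  have nxt: "nxt x = y" if "immediate_succ r x y" for x y
    unfolding nxt_def using immediate_succ_fun[OF r _ that] someI[of "immediate_succ r x", OF that] by blast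
  \<comment> \<open>Stage 1 of the game, if there is one.\<close>
  define one where "one = nxt (SOME z. z \<in> Field r \<and> underS r z = {})"
  have one: "nxt z = one" if z: "z \<in> Field r" "underS r z = {}" for z
  proof -
    have uniq: "z' = z" if "z' \<in> Field r \<and> underS r z' = {}" for z'
      by (rule underS_trichotomy[OF r, of z z']) (use that z in auto)
    have "(SOME z. z \<in> Field r \<and> underS r z = {}) = z"
      by (rule some_equality) (use z uniq in blast)+
    then show ?thesis
      by (simp add: one_def)
  qed
  \<comment> \<open>Odd's first move is the starting point of the descent game.\<close>
  define \<tau> where "\<tau> x p = (if underS r x = {} then top else T (p one) x (\<lambda>y. p (nxt y)))"
    for x and p :: "'a \<Rightarrow> 'q"
  have bound: "\<tau> x (restrict p (underS r x)) \<le> p a"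
    if x: "even_stage r x" and pos: "Even_position r \<tau> x p" and a: "a \<in> underS r x" for x p a
  proof -
    have decr: "p y \<le> p z" if "y \<in> underS r x" "z \<in> underS r y" for y z
      using pos that by (simp add: Even_position_def)
    have follow: "p y = \<tau> y (restrict p (underS r y))" if "even_stage r y" "y \<in> underS r x" for y
      using pos that by (simp add: Even_position_def)
    have xS: "x \<in> S"
      using x a by (auto simp: S_def)
    have nxt_below: "nxt z \<in> underS r y \<and> immediate_succ r z (nxt z)"
      if yz: "even_stage r y" "z \<in> underS r y" "even_stage r z" for y z
    proof -
      obtain c where "immediate_succ r z c" "c = y \<or> c \<in> underS r y"
        by (rule immediate_succ_exists[OF r yz(2)])
      moreover have "odd_stage r c"
        using yz(3) calculation(1) odd_succ by metis
      ultimately show ?thesis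
        using nxt not_even_and_odd_stage[OF r yz(1)] by metis
    qed
    have one_below: "one \<in> underS r y" if y: "y \<in> S" for y
    proof -
      obtain b where b: "b \<in> underS r y"
        using y by (auto simp: S_def)
      obtain z where z: "z \<in> Field r" "\<forall>b\<in>Field r. b = z \<or> z \<in> underS r b"
        by (rule Well_order_least[OF r subset_refl]) (use underS_Field(1)[OF b] in auto)
      have z0: "underS r z = {}"
        using z(2) underS_trans[OF r] underS_irrefl underS_Field(1) by (metis all_not_in_conv)
      then have "even_stage r z"
        using z(1) even_zero_limit[of z r] by (auto simp: immediate_succ_def)
      moreover have "z \<in> underS r y"
        using z(2) b underS_trans[OF r] underS_Field(1) by metis
      ultimately show ?thesis
        using nxt_below y one[OF z(1) z0] by (auto simp: S_def)
    qed
    let ?q = "\<lambda>y. p (nxt y)"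
    have unrestrict: "\<tau> y (restrict p (underS r y)) = T (p one) y ?q" if y: "y \<in> S" for y
    proof -
      have "T (p one) y (\<lambda>z. restrict p (underS r y) (nxt z)) = T (p one) y ?q"
      proof (rule descent_strategyD(1)[OF T y])
        show "restrict p (underS r y) (nxt z) = p (nxt z)" if "z \<in> S" "z \<in> underS r y" for z
          using nxt_below[of y z] y that by (simp add: S_def)
      qed
      then show ?thesis
        using y one_below[OF y] by (simp add: \<tau>_def S_def)
    qed
    have "obeys (T (p one)) (S \<inter> underS r x) ?q"
      unfolding obeys_def
    proof
      fix y assume y: "y \<in> S \<inter> underS r x"
      then have "nxt y \<in> underS r x" "y \<in> underS r (nxt y)"
        using nxt_below[OF x, of y] by (auto simp: S_def immediate_succ_def)
      then have "p (nxt y) \<le> p y"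
        by (rule decr)
      also have "\<dots> = T (p one) y ?q"
        using follow[of y] unrestrict[of y] y by (simp add: S_def)
      finally show "p (nxt y) \<le> T (p one) y ?q" .
    qed
    note low = descent_strategyD(2,3)[OF T xS this]
    obtain z y where zy: "even_stage r z" "immediate_succ r z y" "y \<in> underS r x" "a = z \<or> a = y"
      by (rule odd_stages_cofinal_below_even[OF r x a])
    have z: "z \<in> underS r y" "nxt z = y"
      using zy(2) nxt by (auto simp: immediate_succ_def)
    have "T (p one) x ?q \<le> p y"
    proof (cases "underS r z = {}")
      case True
      then show ?thesis
        using one[OF even_stage_Field[OF zy(1)]] z(2) low(1) by simp
    next
      case False
      then show ?thesis
        using low(2)[of z] zy(1) z underS_trans[OF r z(1) zy(3)] by (simp add: S_def)
    qed
    also have "p y \<le> p a"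
      using zy(4) decr[OF zy(3) z(1)] by auto
    finally show ?thesis
      unfolding unrestrict[OF xS] .
  qed
  have "Even_winning_strategy r \<tau>"
    unfolding Even_winning_strategy_def using bound by (auto simp: \<tau>_def)
  then show ?thesis
    unfolding strategically_closed_def by blast
qed


section \<open>Maximal antichains\<close>

lemma max_antichain_below_singleton: "max_antichain_below X {X}"
  by (fastforce simp: max_antichain_below_def antichain_below_def compat_def)

text \<open>An element below \<open>X\<close> that is incompatible with all of \<open>A\<close> could be added to \<open>A\<close>.\<close>

lemma max_antichain_compat:
  assumes A: "max_antichain_below X A" and x: "x \<le> X"
  obtains a where "a \<in> A" "compat x a"
proof (rule ccontr)
  assume "\<not> thesis"
  then have *: "\<And>a. a \<in> A \<Longrightarrow> \<not> compat x a \<and> \<not> compat a x"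
    using that by (auto simp: compat_def)
  then have "antichain_below X (insert x A)"
    using A x by (auto simp: max_antichain_below_def antichain_below_def)
  then have "x \<in> A"
    using A by (auto simp: max_antichain_below_def)
  then show False
    using * by (auto simp: compat_def)
qed

text \<open>An antichain that is maximal among those contained in \<open>D\<close> is maximal outright: an element \<open>b\<close>
  that could be added to it has some \<open>d\<in>D\<close> below, which could then be added as well.\<close>

lemma max_antichain_in_dense:
  fixes X :: "'q::order"
  assumes D: "\<And>d. d \<in> D \<Longrightarrow> d \<le> X" and dense: "\<And>x. x \<le> X \<Longrightarrow> \<exists>d\<in>D. d \<le> x"
  obtains A where "A \<subseteq> D" "max_antichain_below X A"
proof -
  let ?Z = "{A. A \<subseteq> D \<and> antichain_below X A}"
  have "\<exists>M\<in>?Z. \<forall>A\<in>?Z. M \<subseteq> A \<longrightarrow> A = M"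
  proof (rule subset_Zorn_nonempty)
    show "?Z \<noteq> {}"
      by (auto simp: antichain_below_def)
    fix C assume C: "subset.chain ?Z C"
    then have sub: "C \<subseteq> ?Z" and chain: "\<And>A B. A \<in> C \<Longrightarrow> B \<in> C \<Longrightarrow> A \<subseteq> B \<or> B \<subseteq> A"
      by (auto simp: subset_chain_def)
    have "\<not> compat a b" if ab: "a \<in> \<Union>C" "b \<in> \<Union>C" "a \<noteq> b" for a b
    proof -
      obtain A B where "A \<in> C" "a \<in> A" "B \<in> C" "b \<in> B"
        using ab by blast
      then obtain E where "E \<in> C" "a \<in> E" "b \<in> E"
        using chain by blast
      then show ?thesis
        using sub ab(3) by (auto simp: antichain_below_def)
    qed
    moreover have "\<Union>C \<subseteq> D"
      using sub by blast
    ultimately show "\<Union>C \<in> ?Z"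
      using D by (auto simp: antichain_below_def)
  qed
  then obtain M where M: "M \<subseteq> D" "antichain_below X M"
      and max: "\<And>A. A \<subseteq> D \<Longrightarrow> antichain_below X A \<Longrightarrow> M \<subseteq> A \<Longrightarrow> A = M"
    by auto
  have "b \<in> M" if B: "antichain_below X B" "M \<subseteq> B" and b: "b \<in> B" for B b
  proof (rule ccontr)
    assume notM: "b \<notin> M"
    have "b \<le> X"
      using B(1) b by (auto simp: antichain_below_def)
    then obtain d where d: "d \<in> D" "d \<le> b"
      using dense by blast
    have inc: "\<not> compat d m \<and> \<not> compat m d" if m: "m \<in> M" for m
    proof -
      have "m \<in> B" "m \<noteq> b"
        using B(2) notM m by auto
      then have "\<not> compat b m" "\<not> compat m b"
        using B(1) b unfolding antichain_below_def by metis+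
      then show ?thesis
        using d(2) order_trans by (auto simp: compat_def)
    qed
    then have "antichain_below X (insert d M)"
      using M(2) D[OF d(1)] by (auto simp: antichain_below_def)
    then have "d \<in> M"
      using max[of "insert d M"] d(1) M(1) by auto
    then show False
      using inc by (auto simp: compat_def)
  qed
  then have "max_antichain_below X M"
    using M(2) by (auto simp: max_antichain_below_def)
  with M(1) show thesis
    by (rule that)
qed


section \<open>From the cut and choose game to the descent game\<close>

abbreviation answer ::
  "'g rel \<Rightarrow> ('g \<Rightarrow> ('g \<Rightarrow> 'q set) \<Rightarrow> ('g \<Rightarrow> 'q) \<Rightarrow> 'q) \<Rightarrow> ('g \<Rightarrow> 'q set) \<Rightarrow> ('g \<Rightarrow> 'q) \<Rightarrow> 'g \<Rightarrow> 'q" where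
  "answer \<gamma> \<sigma> A c i \<equiv> \<sigma> i (restrict A (under \<gamma> i)) (restrict c (underS \<gamma> i))"

lemma answer_cong:
  assumes "\<And>j. j \<in> under \<gamma> i \<Longrightarrow> A j = A' j" "\<And>j. j \<in> underS \<gamma> i \<Longrightarrow> c j = c' j"
  shows "answer \<gamma> \<sigma> A c i = answer \<gamma> \<sigma> A' c' i"
proof -
  have "restrict A (under \<gamma> i) = restrict A' (under \<gamma> i)"
       "restrict c (underS \<gamma> i) = restrict c' (underS \<gamma> i)"
    using assms by (auto intro: restrict_ext)
  then show ?thesis
    by simp
qed

lemma follow_strategy_exists:
  assumes "Well_order \<gamma>"
  obtains c where "\<And>i. c i = answer \<gamma> \<sigma> A c i"
  using that worec[OF assms, of "\<lambda>i p. \<sigma> i (restrict A (under \<gamma> i)) p"] by blast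

definition partial_run ::
  "'g rel \<Rightarrow> 'q::order \<Rightarrow> ('g \<Rightarrow> ('g \<Rightarrow> 'q set) \<Rightarrow> ('g \<Rightarrow> 'q) \<Rightarrow> 'q) \<Rightarrow>
     ('g \<Rightarrow> 'q set) \<Rightarrow> ('g \<Rightarrow> 'q) \<Rightarrow> 'g \<Rightarrow> bool" where
  "partial_run \<gamma> X \<sigma> A c i \<longleftrightarrow>
     (\<forall>j\<in>underS \<gamma> i. max_antichain_below X (A j) \<and> c j = answer \<gamma> \<sigma> A c j)"

text \<open>A winning strategy keeps its choices jointly compatible at every stage, because Cut can
  always complete a partial run by trivial moves.\<close>

lemma winning_answer:
  assumes wo: "Well_order \<gamma>" and win: "Choose_winning_strategy \<gamma> X \<sigma>" and i: "i \<in> Field \<gamma>"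
    and run: "partial_run \<gamma> X \<sigma> A c i" and Ai: "max_antichain_below X (A i)"
  shows "answer \<gamma> \<sigma> A c i \<in> A i \<and> (\<exists>b. b \<le> answer \<gamma> \<sigma> A c i \<and> (\<forall>j\<in>underS \<gamma> i. b \<le> c j))"
proof -
  define A' where "A' j = (if j \<in> under \<gamma> i then A j else {X})" for j
  obtain c' where c': "\<And>j. c' j = answer \<gamma> \<sigma> A' c' j"
    using follow_strategy_exists[OF wo] by blast
  have und: "under \<gamma> i = insert i (underS \<gamma> i)"
    by (rule under_eq[OF wo i])
  have und_sub: "under \<gamma> j \<subseteq> under \<gamma> i" if j: "j \<in> under \<gamma> i" for j
    using und under_eq[OF wo, of j] underS_Field(1)[of _ \<gamma> i] i j underS_trans[OF wo, of _ j i] by auto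
  have A'_run: "A' k = A k" if "j \<in> under \<gamma> i" "k \<in> under \<gamma> j" for j k
    using that und_sub by (auto simp: A'_def)
  have same: "c' j = c j" if "j \<in> underS \<gamma> i" for j
    using wo that
  proof (induction j rule: Well_order_induct)
    case (less j)
    have "c' j = answer \<gamma> \<sigma> A c j"
      unfolding c'[of j]
    proof (rule answer_cong)
      show "A' k = A k" if "k \<in> under \<gamma> j" for k
        using A'_run[OF _ that] less.prems und by blast
      show "c' k = c k" if "k \<in> underS \<gamma> j" for k
        using less.IH[OF that] underS_trans[OF wo that less.prems] by blast
    qed
    then show ?case
      using run less.prems by (simp add: partial_run_def)
  qed
  have now: "c' i = answer \<gamma> \<sigma> A c i"
    unfolding c'[of i]
  proof (rule answer_cong)
    show "A' k = A k" if "k \<in> under \<gamma> i" for k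
      using A'_run[OF _ that] und by blast
  qed (rule same)
  have "\<forall>j\<in>Field \<gamma>. max_antichain_below X (A' j)"
    using run Ai und max_antichain_below_singleton by (auto simp: A'_def partial_run_def)
  then have "(\<forall>j\<in>Field \<gamma>. c' j \<in> A' j) \<and> (\<exists>q. \<forall>j\<in>Field \<gamma>. q \<le> c' j)"
    using win c' unfolding Choose_winning_strategy_def by blast
  then obtain q where q: "c' i \<in> A' i" "\<forall>j\<in>Field \<gamma>. q \<le> c' j"
    using i by blast
  have "A' i = A i"
    using und by (simp add: A'_def)
  moreover have "\<forall>j\<in>underS \<gamma> i. q \<le> c j"
    using q(2) same underS_Field(1)[of _ \<gamma> i] by metis
  moreover have "q \<le> answer \<gamma> \<sigma> A c i"
    using q(2) i unfolding now[symmetric] by blast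
  moreover have "answer \<gamma> \<sigma> A c i \<in> A' i"
    using q(1) unfolding now .
  ultimately show ?thesis
    by auto
qed

text \<open>Distributivity: if every extension of \<open>x\<close> is compatible with every \<open>c j\<close>, then the elements
  below both \<open>x\<close> and \<open>c j\<close> are dense below \<open>x\<close>. When Cut plays maximal antichains below \<open>x\<close> of
  such elements, the lower bound that Choose secures is below \<open>x\<close> and all \<open>c j\<close>.\<close>

lemma decide_lower_bound:
  fixes x :: "'q::order"
  assumes wo: "Well_order \<gamma>" and ne: "Field \<gamma> \<noteq> {}" and wins: "\<And>X :: 'q. Choose_wins X \<gamma>"
    and J: "J \<subseteq> Field \<gamma>"
  obtains d where "d \<le> x" "(\<forall>j\<in>J. d \<le> c j) \<or> (\<exists>j\<in>J. \<not> compat d (c j))"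
proof (cases "\<exists>d\<le>x. \<exists>j\<in>J. \<not> compat d (c j)")
  case True
  then show thesis
    using that by blast
next
  case False
  have "\<exists>A. max_antichain_below x A \<and> (j \<in> J \<longrightarrow> (\<forall>a\<in>A. a \<le> c j))" for j
  proof (cases "j \<in> J")
    case True
    have "\<exists>d\<in>{d. d \<le> x \<and> d \<le> c j}. d \<le> y" if y: "y \<le> x" for y
    proof -
      have "compat y (c j)"
        using False True y by blast
      then show ?thesis
        using y order_trans by (auto simp: compat_def)
    qed
    then obtain A where "A \<subseteq> {d. d \<le> x \<and> d \<le> c j}" "max_antichain_below x A"
      using max_antichain_in_dense[of "{d. d \<le> x \<and> d \<le> c j}" x] by blast
    then show ?thesis
      by blast
  qed (use max_antichain_below_singleton in blast)
  then obtain A where A: "\<And>j. max_antichain_below x (A j)" "\<And>j a. j \<in> J \<Longrightarrow> a \<in> A j \<Longrightarrow> a \<le> c j"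
    by metis
  obtain \<sigma> where \<sigma>: "Choose_winning_strategy \<gamma> x \<sigma>"
    using wins unfolding Choose_wins_def by blast
  obtain c' where "\<And>j. c' j = answer \<gamma> \<sigma> A c' j"
    using follow_strategy_exists[OF wo] by blast
  then have "(\<forall>j\<in>Field \<gamma>. c' j \<in> A j) \<and> (\<exists>q. \<forall>j\<in>Field \<gamma>. q \<le> c' j)"
    using \<sigma> A(1) unfolding Choose_winning_strategy_def by blast
  then obtain q where q: "\<And>j. j \<in> Field \<gamma> \<Longrightarrow> c' j \<in> A j" "\<And>j. j \<in> Field \<gamma> \<Longrightarrow> q \<le> c' j"
    by blast
  have "q \<le> c j" if "j \<in> J" for j
    using q[of j] A(2)[OF that, of "c' j"] J that order_trans by blast
  moreover have "q \<le> x"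
  proof -
    obtain k where k: "k \<in> Field \<gamma>"
      using ne by blast
    then have "c' k \<le> x"
      using q(1)[OF k] A(1)[of k] by (auto simp: max_antichain_below_def antichain_below_def)
    then show ?thesis
      using q(2)[OF k] order_trans by blast
  qed
  ultimately show thesis
    using that by blast
qed

text \<open>A move of Even after which every move of Odd can be explained as an answer of \<open>\<sigma>\<close> to a suitable
  antichain of Cut.\<close>

definition good_move ::
  "'g rel \<Rightarrow> 'q::order \<Rightarrow> ('g \<Rightarrow> ('g \<Rightarrow> 'q set) \<Rightarrow> ('g \<Rightarrow> 'q) \<Rightarrow> 'q) \<Rightarrow>
     ('g \<Rightarrow> 'q set) \<Rightarrow> ('g \<Rightarrow> 'q) \<Rightarrow> 'g \<Rightarrow> 'q \<Rightarrow> bool" where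
  "good_move \<gamma> X \<sigma> A c i p \<longleftrightarrow>
     p \<le> X \<and> (\<forall>j\<in>underS \<gamma> i. p \<le> c j) \<and>
     (\<forall>r\<le>p. \<exists>B. max_antichain_below X B \<and> answer \<gamma> \<sigma> (A(i := B)) c i = r)"

text \<open>Suppose that densely many \<open>r \<le> X\<close> are either incompatible with an earlier choice or not the
  answer of \<open>\<sigma>\<close> to any antichain. Let Cut play a maximal antichain of such \<open>r\<close>. The answer of \<open>\<sigma>\<close>
  lies in it, but is compatible with the earlier choices because \<open>\<sigma>\<close> wins. So below
  some \<open>x\<close> there is no such \<open>r\<close>, and by distributivity \<open>x\<close> has an extension below all earlier
  choices.\<close>

lemma good_move_exists:
  fixes X :: "'q::order"
  assumes wo: "Well_order \<gamma>" and wins: "\<And>X :: 'q. Choose_wins X \<gamma>"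
    and win: "Choose_winning_strategy \<gamma> X \<sigma>" and i: "i \<in> Field \<gamma>"
    and run: "partial_run \<gamma> X \<sigma> A c i"
  shows "\<exists>p. good_move \<gamma> X \<sigma> A c i p"
proof -
  define reachable where
    "reachable r \<longleftrightarrow> (\<exists>B. max_antichain_below X B \<and> answer \<gamma> \<sigma> (A(i := B)) c i = r)" for r
  define D where
    "D = {r. r \<le> X \<and> ((\<exists>j\<in>underS \<gamma> i. \<not> compat r (c j)) \<or> \<not> reachable r)}"
  have "\<exists>x\<le>X. \<forall>d\<in>D. \<not> d \<le> x"
  proof (rule ccontr)
    assume "\<not> (\<exists>x\<le>X. \<forall>d\<in>D. \<not> d \<le> x)"
    then have "\<And>x. x \<le> X \<Longrightarrow> \<exists>d\<in>D. d \<le> x"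
      by blast
    then obtain B where B: "B \<subseteq> D" "max_antichain_below X B"
      using max_antichain_in_dense[of D X] by (auto simp: D_def)
    let ?A = "A(i := B)"
    have "answer \<gamma> \<sigma> ?A c j = answer \<gamma> \<sigma> A c j" if j: "j \<in> underS \<gamma> i" for j
    proof (rule answer_cong)
      have "i \<notin> under \<gamma> j"
        using under_eq[OF wo underS_Field(1)[OF j]] j underS_trans[OF wo, of i j i] underS_irrefl[of i \<gamma>] by auto
      then show "\<And>k. k \<in> under \<gamma> j \<Longrightarrow> ?A k = A k"
        by auto
    qed simp
    then have "partial_run \<gamma> X \<sigma> ?A c i"
      using run underS_irrefl[of i \<gamma>] by (auto simp: partial_run_def)
    moreover have "max_antichain_below X (?A i)"
      using B(2) by simp
    ultimately have a: "answer \<gamma> \<sigma> ?A c i \<in> ?A i"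
        "\<exists>b. b \<le> answer \<gamma> \<sigma> ?A c i \<and> (\<forall>j\<in>underS \<gamma> i. b \<le> c j)"
      using winning_answer[OF wo win i, of ?A c] by blast+
    then have "answer \<gamma> \<sigma> ?A c i \<in> D"
      using B(1) by auto
    moreover have "reachable (answer \<gamma> \<sigma> ?A c i)"
      using B(2) unfolding reachable_def by blast
    moreover have "\<forall>j\<in>underS \<gamma> i. compat (answer \<gamma> \<sigma> ?A c i) (c j)"
      using a(2) unfolding compat_def by blast
    ultimately show False
      unfolding D_def by blast
  qed
  then obtain x where x: "x \<le> X" "\<And>d. d \<in> D \<Longrightarrow> \<not> d \<le> x"
    by blast
  have below_x: "reachable r \<and> (\<forall>j\<in>underS \<gamma> i. compat r (c j))" if r: "r \<le> x" for r
    using x(2)[of r] r order_trans[OF r x(1)] unfolding D_def by blast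
  have "underS \<gamma> i \<subseteq> Field \<gamma>"
    using underS_Field(1) by fast
  then obtain p where p: "p \<le> x" "(\<forall>j\<in>underS \<gamma> i. p \<le> c j) \<or> (\<exists>j\<in>underS \<gamma> i. \<not> compat p (c j))"
    using decide_lower_bound[OF wo _ wins] i by blast
  have "good_move \<gamma> X \<sigma> A c i p"
    using p below_x x(1) order_trans unfolding good_move_def reachable_def by blast
  then show ?thesis
    by blast
qed

text \<open>From the moves \<open>q\<close> of Odd, Even reconstructs a run of the cut and choose game below \<open>X\<close>. In
  the rounds of \<open>R\<close> the choice is \<open>q j\<close>, and Cut plays an antichain from which \<open>\<sigma>\<close> picks it.
  In the other rounds Cut plays \<open>{X}\<close>, so that the choice is \<open>X\<close> and imposes no restriction;
  this is what makes arbitrary sets of rounds possible.\<close>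

lemma descent_if_Choose_wins:
  fixes \<gamma> :: "'g rel" and X :: "'q::order"
  assumes wo: "Well_order \<gamma>" and ne: "Field \<gamma> \<noteq> {}" and wins: "\<And>X :: 'q. Choose_wins X \<gamma>"
    and R: "R \<subseteq> Field \<gamma>"
  shows "\<exists>\<tau>. descent_strategy \<gamma> R X \<tau>"
proof -
  obtain \<sigma> where win: "Choose_winning_strategy \<gamma> X \<sigma>"
    using wins unfolding Choose_wins_def by blast
  \<comment> \<open>The run determined by \<open>q\<close>: the choices \<open>c\<close>, and the antichains \<open>A\<close> of Cut, found by recursion;
     the argument \<open>P\<close> of \<open>cut\<close> holds the earlier antichains.\<close>
  define c where "c q j = (if j \<in> R then q j else X)" for q :: "'g \<Rightarrow> 'q" and j
  define cut where "cut q j P = (if j \<in> R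
      then SOME B. max_antichain_below X B \<and> answer \<gamma> \<sigma> (P(j := B)) (c q) j = q j else {X})"
    for q :: "'g \<Rightarrow> 'q" and j and P :: "'g \<Rightarrow> 'q set"
  define A where "A q = worec \<gamma> (cut q)" for q
  define \<tau> where "\<tau> i q = (SOME p. good_move \<gamma> X \<sigma> (A q) (c q) i p)" for i q
  have A: "A q j = (if j \<in> R
      then SOME B. max_antichain_below X B \<and> answer \<gamma> \<sigma> ((A q)(j := B)) (c q) j = q j else {X})"
    if j: "j \<in> Field \<gamma>" for q j
  proof -
    have "answer \<gamma> \<sigma> ((restrict (A q) (underS \<gamma> j))(j := B)) (c q) j
        = answer \<gamma> \<sigma> ((A q)(j := B)) (c q) j" for B
      by (rule answer_cong) (auto simp: under_eq[OF wo j])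
    then show ?thesis
      unfolding A_def by (subst worec[OF wo]) (simp only: cut_def flip: A_def)
  qed
  have c_cong: "c q j = c q' j" if "\<And>y. y \<in> R \<Longrightarrow> y \<in> underS \<gamma> i \<Longrightarrow> q y = q' y" "j \<in> underS \<gamma> i"
    for q q' i j
    using that by (simp add: c_def)
  have A_cong: "A q j = A q' j"
    if eq: "\<And>y. y \<in> R \<Longrightarrow> y \<in> underS \<gamma> i \<Longrightarrow> q y = q' y" and j: "j \<in> underS \<gamma> i" for q q' i j
    unfolding A_def
  proof (rule worec_cong[OF wo])
    fix y P assume "y = j \<or> y \<in> underS \<gamma> j"
    then have y: "y \<in> underS \<gamma> i"
      using j underS_trans[OF wo] by blast
    have "answer \<gamma> \<sigma> (P(y := B)) (c q) y = answer \<gamma> \<sigma> (P(y := B)) (c q') y" for B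
      by (rule answer_cong) (use c_cong[OF eq] underS_trans[OF wo _ y] in auto)
    then show "cut q y P = cut q' y P"
      using eq[OF _ y] by (simp add: cut_def)
  qed
  have run: "max_antichain_below X (A q j) \<and> c q j = answer \<gamma> \<sigma> (A q) (c q) j"
    if "j \<in> Field \<gamma>" "\<And>k. k \<in> R \<Longrightarrow> k \<in> under \<gamma> j \<Longrightarrow> q k \<le> \<tau> k q" for q j
    using wo that
  proof (induction j rule: Well_order_induct)
    case (less j)
    note j = less.prems(1)
    have past: "partial_run \<gamma> X \<sigma> (A q) (c q) j"
      unfolding partial_run_def
    proof
      fix k assume k: "k \<in> underS \<gamma> j"
      show "max_antichain_below X (A q k) \<and> c q k = answer \<gamma> \<sigma> (A q) (c q) k"
      proof (rule less.IH[OF k underS_Field(1)[OF k]])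
        show "q l \<le> \<tau> l q" if l: "l \<in> R" "l \<in> under \<gamma> k" for l
          using less.prems(2)[OF l(1)] l(2) k under_eq[OF wo j] under_eq[OF wo underS_Field(1)[OF k]]
            underS_trans[OF wo _ k] by auto
      qed
    qed
    show ?case
    proof (cases "j \<in> R")
      case True
      have "good_move \<gamma> X \<sigma> (A q) (c q) j (\<tau> j q)"
        unfolding \<tau>_def by (rule someI_ex) (rule good_move_exists[OF wo wins win j past])
      moreover have "q j \<le> \<tau> j q"
        using less.prems(2)[OF True] under_eq[OF wo j] by simp
      ultimately have "\<exists>B. max_antichain_below X B \<and> answer \<gamma> \<sigma> ((A q)(j := B)) (c q) j = q j"
        unfolding good_move_def by blast
      then have "max_antichain_below X (A q j) \<and> answer \<gamma> \<sigma> ((A q)(j := A q j)) (c q) j = q j"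
        using A[OF j, of q] True
        by (metis (mono_tags, lifting) someI_ex)
      moreover have "c q j = q j"
        using True by (simp add: c_def)
      ultimately show ?thesis
        by (metis fun_upd_triv)
    next
      case False
      then have Aj: "A q j = {X}"
        using A[OF j] by simp
      then have "max_antichain_below X (A q j)"
        using max_antichain_below_singleton by simp
      moreover have "answer \<gamma> \<sigma> (A q) (c q) j = X"
        using winning_answer[OF wo win j past calculation] Aj by blast
      moreover have "c q j = X"
        using False by (simp add: c_def)
      ultimately show ?thesis
        by metis
    qed
  qed
  have good: "good_move \<gamma> X \<sigma> (A q) (c q) i (\<tau> i q)"
    if i: "i \<in> R" and q: "obeys \<tau> (R \<inter> underS \<gamma> i) q" for i q
  proof -
    have "partial_run \<gamma> X \<sigma> (A q) (c q) i"
      unfolding partial_run_def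
    proof
      fix j assume j: "j \<in> underS \<gamma> i"
      show "max_antichain_below X (A q j) \<and> c q j = answer \<gamma> \<sigma> (A q) (c q) j"
      proof (rule run[OF underS_Field(1)[OF j]])
        show "q k \<le> \<tau> k q" if "k \<in> R" "k \<in> under \<gamma> j" for k
          using obeysD[OF q, of k] that under_eq[OF wo underS_Field(1)[OF j]] j
            underS_trans[OF wo _ j] by auto
      qed
    qed
    then have "\<exists>p. good_move \<gamma> X \<sigma> (A q) (c q) i p"
      using good_move_exists[OF wo wins win] i R by blast
    then show ?thesis
      unfolding \<tau>_def by (rule someI_ex)
  qed
  have "descent_strategy \<gamma> R X \<tau>"
  proof (rule descent_strategyI)
    fix i q q' assume "i \<in> R" and eq: "\<And>y. y \<in> R \<Longrightarrow> y \<in> underS \<gamma> i \<Longrightarrow> q y = (q' y :: 'q)"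
    then have i: "i \<in> Field \<gamma>"
      using R by blast
    have "answer \<gamma> \<sigma> ((A q)(i := B)) (c q) i = answer \<gamma> \<sigma> ((A q')(i := B)) (c q') i" for B
    proof (rule answer_cong)
      show "((A q)(i := B)) k = ((A q')(i := B)) k" if "k \<in> under \<gamma> i" for k
        using A_cong[of i q q' k, OF eq] that under_eq[OF wo i] by auto
      show "c q k = c q' k" if "k \<in> underS \<gamma> i" for k
        by (rule c_cong[OF eq that])
    qed
    moreover have "(\<forall>j\<in>underS \<gamma> i. p \<le> c q j) \<longleftrightarrow> (\<forall>j\<in>underS \<gamma> i. p \<le> c q' j)" for p
    proof (rule ball_cong[OF refl])
      show "p \<le> c q j \<longleftrightarrow> p \<le> c q' j" if "j \<in> underS \<gamma> i" for j
        using c_cong[of i q q' j, OF eq that] by simp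
    qed
    ultimately show "\<tau> i q = \<tau> i q'"
      unfolding \<tau>_def good_move_def by (simp only:)
  next
    fix q assume q: "obeys \<tau> R q"
    have full: "max_antichain_below X (A q j) \<and> c q j = answer \<gamma> \<sigma> (A q) (c q) j"
      if "j \<in> Field \<gamma>" for j
      using run[OF that] obeysD[OF q] by blast
    then have "(\<forall>j\<in>Field \<gamma>. c q j \<in> A q j) \<and> (\<exists>b. \<forall>j\<in>Field \<gamma>. b \<le> c q j)"
      using win unfolding Choose_winning_strategy_def by blast
    then obtain b where b: "\<And>j. j \<in> Field \<gamma> \<Longrightarrow> c q j \<in> A q j" "\<And>j. j \<in> Field \<gamma> \<Longrightarrow> b \<le> c q j"
      by blast
    obtain k where k: "k \<in> Field \<gamma>"
      using ne by blast
    have "c q k \<le> X"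
      using b(1)[OF k] full[OF k] by (auto simp: max_antichain_below_def antichain_below_def)
    then have "b \<le> X"
      using b(2)[OF k] order_trans by blast
    moreover have "b \<le> q j" if "j \<in> R" for j
      using b(2)[of j] that R by (auto simp: c_def)
    ultimately show "\<exists>b\<le>X. \<forall>j\<in>R. b \<le> q j"
      by blast
  next
    fix i q assume "i \<in> R" "obeys \<tau> (R \<inter> underS \<gamma> i) q"
    then have g: "good_move \<gamma> X \<sigma> (A q) (c q) i (\<tau> i q)"
      by (rule good)
    then show "\<tau> i q \<le> X"
      by (simp add: good_move_def)
    show "\<tau> i q \<le> q y" if "y \<in> R" "y \<in> underS \<gamma> i" for y
    proof -
      have "\<tau> i q \<le> c q y"
        using g that(2) by (simp add: good_move_def)
      then show ?thesis
        using that(1) by (simp add: c_def)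
    qed
  qed
  then show ?thesis
    by blast
qed


section \<open>From strategic closure to the cut and choose game\<close>

lemma limit_ordinal_infinite:
  assumes "limit_ordinal \<gamma>"
  shows "infinite (Field \<gamma>)"
proof
  assume fin: "finite (Field \<gamma>)"
  have wo: "Well_order \<gamma>" and ne: "Field \<gamma> \<noteq> {}" and lim: "\<And>a. a \<in> Field \<gamma> \<Longrightarrow> aboveS \<gamma> a \<noteq> {}"
    using assms by (auto simp: limit_ordinal_def)
  have "\<gamma> \<subseteq> Field \<gamma> \<times> Field \<gamma>"
    by (auto simp: Field_def)
  then have "finite (\<gamma> - Id)"
    using fin finite_subset[of \<gamma> "Field \<gamma> \<times> Field \<gamma>"] by auto
  then have "wf ((\<gamma> - Id)\<inverse>)"
    by (rule finite_acyclic_wf_converse) (rule wf_acyclic[OF Well_order_wf[OF wo]])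
  then obtain m where m: "m \<in> Field \<gamma>" "\<And>y. (y, m) \<in> (\<gamma> - Id)\<inverse> \<Longrightarrow> y \<notin> Field \<gamma>"
    using ne wfE_min by (metis ex_in_conv)
  obtain y where "y \<noteq> m" "(m, y) \<in> \<gamma>"
    using lim[OF m(1)] by (auto simp: aboveS_def)
  then show False
    using m(2)[of y] by (auto simp: Field_def)
qed

text \<open>By regularity a small set is bounded, and among the next two stages above a bound one is odd.\<close>

lemma odd_stage_above:
  assumes card: "Card_order r" and reg: "regularCard r" and inf: "infinite (Field r)"
    and K: "K \<subseteq> Field r" "|K| <o r"
  shows "\<exists>t. odd_stage r t \<and> K \<subseteq> underS r t"
proof -
  have wo: "Well_order r"
    using card by (simp add: card_order_on_def)
  have succ: "\<exists>b. immediate_succ r a b" if a: "a \<in> Field r" for a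
  proof -
    obtain b where "a \<in> underS r b"
      using infinite_Card_order_limit[OF card inf a] by (auto simp: underS_def)
    then show ?thesis
      using immediate_succ_exists[OF wo] by metis
  qed
  have "\<not> cofinal K r"
    using reg K not_ordLess_ordIso unfolding regularCard_def by blast
  then obtain a where a: "a \<in> Field r" "\<And>k. k \<in> K \<Longrightarrow> a = k \<or> (a, k) \<notin> r"
    unfolding cofinal_def by blast
  have K_le: "k = a \<or> k \<in> underS r a" if k: "k \<in> K" for k
  proof (rule underS_trichotomy[OF wo, of k a])
    show "k \<in> Field r" "a \<in> Field r"
      using k K(1) a(1) by auto
    show "k = a \<or> k \<in> underS r a" if "a \<in> underS r k"
      using that a(2)[OF k] by (auto simp: underS_def)
  qed auto
  obtain b where b: "immediate_succ r a b"
    using succ[OF a(1)] by blast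
  obtain c where c: "immediate_succ r b c"
    using succ[OF immediate_succ_Field(2)[OF b]] by blast
  have ab: "a \<in> underS r b" and bc: "b \<in> underS r c"
    using b c by (auto simp: immediate_succ_def)
  have "odd_stage r b \<or> odd_stage r c"
    using even_or_odd_stage[OF wo immediate_succ_Field(2)[OF b]] odd_succ[OF _ c] by blast
  moreover have Kb: "K \<subseteq> underS r b"
    using K_le ab underS_trans[OF wo _ ab] by blast
  moreover have "K \<subseteq> underS r c"
    using Kb underS_trans[OF wo _ bc] by blast
  ultimately show ?thesis
    by blast
qed

text \<open>Inside the regular cardinal \<open>cardSuc |Field s|\<close> odd stages can be chosen recursively, each
  above all earlier ones, and in the end a stage above all of them; cutting off the cardinal
  beyond that stage gives \<open>\<alpha>\<close>.\<close>

lemma odd_stage_embedding: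
  fixes s :: "'g rel"
  assumes s: "Well_order s" and inf: "infinite (Field s)"
  obtains \<alpha> :: "'g set rel" and h t where
    "\<alpha> <o cardSuc |Field s|" "even_stage \<alpha> t"
    "\<And>i. i \<in> Field s \<Longrightarrow> odd_stage \<alpha> (h i)" "\<And>i. i \<in> Field s \<Longrightarrow> h i \<in> underS \<alpha> t"
    "\<And>i j. i \<in> Field s \<Longrightarrow> j \<in> underS s i \<Longrightarrow> h j \<in> underS \<alpha> (h i)"
proof -
  define \<Lambda> where "\<Lambda> = cardSuc |Field s|"
  have card: "Card_order \<Lambda>"
    unfolding \<Lambda>_def by (rule cardSuc_Card_order) (rule card_of_Card_order)
  then have wo: "Well_order \<Lambda>"
    by (simp add: card_order_on_def)
  have infL: "infinite (Field \<Lambda>)"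
    using inf unfolding \<Lambda>_def by (simp add: card_of_cardSuc_finite)
  have reg: "regularCard \<Lambda>"
    unfolding \<Lambda>_def using inf card_of_Card_order[of "Field s"]
    by (intro infinite_cardSuc_regularCard) (simp_all only: Field_card_of not_False_eq_True)
  have above: "\<exists>t. odd_stage \<Lambda> t \<and> h ` J \<subseteq> underS \<Lambda> t" if "J \<subseteq> Field s" "h ` J \<subseteq> Field \<Lambda>"
    for J and h :: "'g \<Rightarrow> 'g set"
  proof (rule odd_stage_above[OF card reg infL that(2)])
    have "|h ` J| \<le>o |Field s|"
      using card_of_image card_of_mono1[OF that(1)] ordLeq_transitive by blast
    then show "|h ` J| <o \<Lambda>"
      unfolding \<Lambda>_def using cardSuc_greater[OF card_of_Card_order] ordLeq_ordLess_trans by blast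
  qed
  define G where "G i p = (SOME t. odd_stage \<Lambda> t \<and> p ` underS s i \<subseteq> underS \<Lambda> t)"
    for i and p :: "'g \<Rightarrow> 'g set"
  define h where "h = worec s G"
  have h: "h i = (SOME t. odd_stage \<Lambda> t \<and> h ` underS s i \<subseteq> underS \<Lambda> t)" for i
  proof -
    have "h i = G i (restrict h (underS s i))"
      unfolding h_def by (rule worec[OF s])
    also have "restrict h (underS s i) ` underS s i = h ` underS s i"
      by auto
    then have "G i (restrict h (underS s i)) = (SOME t. odd_stage \<Lambda> t \<and> h ` underS s i \<subseteq> underS \<Lambda> t)"
      unfolding G_def by simp
    finally show ?thesis .
  qed
  have h_odd: "odd_stage \<Lambda> (h i) \<and> h ` underS s i \<subseteq> underS \<Lambda> (h i)" for i
    using s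
  proof (induction i rule: Well_order_induct)
    case (less i)
    have "h ` underS s i \<subseteq> Field \<Lambda>"
    proof (rule image_subsetI)
      show "h j \<in> Field \<Lambda>" if "j \<in> underS s i" for j
        using less.IH[OF that] by (blast intro: odd_stage_Field)
    qed
    moreover have "underS s i \<subseteq> Field s"
      using underS_Field(1) by fast
    ultimately have "\<exists>t. odd_stage \<Lambda> t \<and> h ` underS s i \<subseteq> underS \<Lambda> t"
      using above by blast
    then show ?case
      unfolding h[of i] by (rule someI_ex)
  qed
  have "h ` Field s \<subseteq> Field \<Lambda>"
    using h_odd by (auto intro: odd_stage_Field)
  then obtain t' where t': "odd_stage \<Lambda> t'" "h ` Field s \<subseteq> underS \<Lambda> t'"
    using above[OF subset_refl, of h] by blast
  obtain u where u: "t' \<in> underS \<Lambda> u"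
    using infinite_Card_order_limit[OF card infL odd_stage_Field[OF t'(1)]] by (auto simp: underS_def)
  obtain t where t: "immediate_succ \<Lambda> t' t"
    using immediate_succ_exists[OF wo u] by metis
  then have even: "even_stage \<Lambda> t" and tt': "t' \<in> underS \<Lambda> t"
    using even_succ[OF t'(1) t] t by (simp_all add: immediate_succ_def)
  obtain v where v: "t \<in> underS \<Lambda> v"
    using infinite_Card_order_limit[OF card infL even_stage_Field[OF even]] by (auto simp: underS_def)
  let ?\<alpha> = "Restr \<Lambda> (underS \<Lambda> v)"
  have ht: "h i \<in> underS \<Lambda> t" if "i \<in> Field s" for i
    using t'(2) that underS_trans[OF wo _ tt'] by blast
  have hv: "h i \<in> underS \<Lambda> v" if "i \<in> Field s" for i
    using underS_trans[OF wo ht[OF that] v] .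
  show thesis
  proof (rule that)
    have "?\<alpha> <o |Field \<Lambda>|"
      using card Card_order_iff_Restr_underS[OF wo] underS_Field(2)[OF v] by blast
    then show "?\<alpha> <o cardSuc |Field s|"
      using card_of_Field_ordIso[OF card] ordLess_ordIso_trans unfolding \<Lambda>_def by blast
    show "even_stage ?\<alpha> t"
      using parity_Restr_underS[OF wo v] even by blast
    fix i assume i: "i \<in> Field s"
    show "odd_stage ?\<alpha> (h i)"
      using parity_Restr_underS[OF wo hv[OF i]] h_odd by blast
    show "h i \<in> underS ?\<alpha> t"
      using ht[OF i] underS_Restr_underS[OF wo v] by blast
    show "h j \<in> underS ?\<alpha> (h i)" if "j \<in> underS s i" for j
      using h_odd[of i] that underS_Restr_underS[OF wo hv[OF i]] by blast
  qed
qed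

text \<open>In the run \<open>P A\<close>, Even follows \<open>\<tau>\<close> and Odd's moves are all below \<open>X\<close>, at stage \<open>h i\<close> moreover below
  an element of \<open>A i\<close>. Odd's move is possible because the preceding move of Even is either the top
  element or below an earlier move of Odd, hence below \<open>X\<close>, and there the maximal antichain \<open>A i\<close> has a
  compatible element. Since \<open>h\<close> is increasing, \<open>P A\<close> at stage \<open>h i\<close> depends only on the antichains
  up to round \<open>i\<close>, as required of a strategy for Choose.\<close>

lemma Choose_wins_if_Even_wins:
  fixes \<gamma> :: "'g rel" and \<alpha> :: "'a rel" and X :: "'q::order_top"
    and \<tau> :: "'a \<Rightarrow> ('a \<Rightarrow> 'q) \<Rightarrow> 'q"
  assumes wo: "Well_order \<gamma>" and \<alpha>: "Well_order \<alpha>" and win: "Even_winning_strategy \<alpha> \<tau>"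
    and t: "even_stage \<alpha> t"
    and h_odd: "\<And>i. i \<in> Field \<gamma> \<Longrightarrow> odd_stage \<alpha> (h i)"
    and h_t: "\<And>i. i \<in> Field \<gamma> \<Longrightarrow> h i \<in> underS \<alpha> t"
    and h_mono: "\<And>i j. i \<in> Field \<gamma> \<Longrightarrow> j \<in> underS \<gamma> i \<Longrightarrow> h j \<in> underS \<alpha> (h i)"
  shows "Choose_wins X \<gamma>"
proof -
  \<comment> \<open>One step of the run: the predecessor \<open>e\<close> of an odd stage is the preceding stage of Even.\<close>
  define G where "G A x p = (if even_stage \<alpha> x then \<tau> x p
      else SOME r. r \<le> p (SOME e. immediate_succ \<alpha> e x) \<and> r \<le> X \<and>
        (\<forall>i\<in>Field \<gamma>. h i = x \<longrightarrow> (\<exists>a\<in>A i. r \<le> a)))"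
    for A :: "'g \<Rightarrow> 'q set" and x and p :: "'a \<Rightarrow> 'q"
  define P where "P A = worec \<alpha> (G A)" for A
  have P: "P A x = G A x (restrict (P A) (underS \<alpha> x))" for A x
    unfolding P_def by (rule worec[OF \<alpha>])
  have h_inj: "i = j" if "i \<in> Field \<gamma>" "j \<in> Field \<gamma>" "h i = h j" for i j
    using underS_trichotomy[OF wo that(1,2)] h_mono[of i j] h_mono[of j i] that
      underS_irrefl[of "h i" \<alpha>] by metis
  have play: "(\<forall>y\<in>underS \<alpha> x. P A x \<le> P A y) \<and>
      (odd_stage \<alpha> x \<longrightarrow> P A x \<le> X \<and> (\<forall>i\<in>Field \<gamma>. h i = x \<longrightarrow> (\<exists>a\<in>A i. P A x \<le> a)))"
    if "x \<in> Field \<alpha>" and A: "\<And>i. i \<in> Field \<gamma> \<Longrightarrow> max_antichain_below X (A i)" for A x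
    using \<alpha> that(1)
  proof (induction x rule: Well_order_induct)
    case (less x)
    have IH: "P A y \<le> P A z" if "y \<in> underS \<alpha> x" "z \<in> underS \<alpha> y" for y z
      using less.IH[OF that(1) underS_Field(1)[OF that(1)]] that(2) by blast
    have IH_X: "P A y \<le> X" if "y \<in> underS \<alpha> x" "odd_stage \<alpha> y" for y
      using less.IH[OF that(1) underS_Field(1)[OF that(1)]] that(2) by blast
    have pos: "Even_position \<alpha> \<tau> y (P A)" if "y = x \<or> y \<in> underS \<alpha> x" for y
    proof -
      have "z \<in> underS \<alpha> x" if "z \<in> underS \<alpha> y" for z
        using that \<open>y = x \<or> y \<in> underS \<alpha> x\<close> underS_trans[OF \<alpha>, of z y x] by blast
      moreover have "P A z = \<tau> z (restrict (P A) (underS \<alpha> z))" if "even_stage \<alpha> z" for z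
        using P[of A z] that by (simp only: G_def if_True)
      ultimately show ?thesis
        unfolding Even_position_def using IH by blast
    qed
    have legal: "(underS \<alpha> y = {} \<longrightarrow> P A y = top) \<and> (\<forall>z\<in>underS \<alpha> y. P A y \<le> P A z)"
      if "y = x \<or> y \<in> underS \<alpha> x" "even_stage \<alpha> y" for y
    proof -
      have "P A y = \<tau> y (restrict (P A) (underS \<alpha> y))"
        using P[of A y] that(2) by (simp only: G_def if_True)
      then show ?thesis
        using win pos[OF that(1)] that(2) unfolding Even_winning_strategy_def by simp
    qed
    show ?case
    proof (cases "even_stage \<alpha> x")
      case True
      then show ?thesis
        using legal[of x] not_even_and_odd_stage[OF \<alpha> True] by blast
    next
      case False
      then have "odd_stage \<alpha> x"
        using even_or_odd_stage[OF \<alpha> less.prems] by blast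
      then obtain e where e: "even_stage \<alpha> e" "immediate_succ \<alpha> e x"
        by (cases rule: odd_stage.cases)
      then have ex: "e \<in> underS \<alpha> x"
        by (simp add: immediate_succ_def)
      have some_e: "(SOME e. immediate_succ \<alpha> e x) = e"
        using e(2) immediate_succ_inj[OF \<alpha>] by blast
      obtain y where y: "y \<le> P A e" "y \<le> X"
      proof (cases "underS \<alpha> e = {}")
        case True
        then have "P A e = top"
          using legal[of e] ex e(1) by blast
        then show thesis
          using that[of X] by simp
      next
        case False
        then obtain b where "b \<in> underS \<alpha> e"
          by blast
        then obtain u w where "even_stage \<alpha> u" "immediate_succ \<alpha> u w" "w \<in> underS \<alpha> e"
          using odd_stages_cofinal_below_even[OF \<alpha> e(1)] by metis
        then have "odd_stage \<alpha> w" "w \<in> underS \<alpha> e" "w \<in> underS \<alpha> x"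
          using odd_succ underS_trans[OF \<alpha> _ ex] by metis+
        then have "P A e \<le> X"
          using IH[OF ex] IH_X order_trans by metis
        then show thesis
          using that by blast
      qed
      have "\<exists>r. r \<le> P A e \<and> r \<le> X \<and> (\<forall>i\<in>Field \<gamma>. h i = x \<longrightarrow> (\<exists>a\<in>A i. r \<le> a))"
      proof (cases "\<exists>i\<in>Field \<gamma>. h i = x")
        case True
        then obtain i where i: "i \<in> Field \<gamma>" "h i = x"
          by blast
        obtain a where "a \<in> A i" "compat y a"
          by (rule max_antichain_compat[OF A[OF i(1)] y(2)])
        then obtain r where "r \<le> y" "r \<le> a" "a \<in> A i"
          by (auto simp: compat_def)
        then show ?thesis
          using y h_inj[OF i(1)] i(2) order_trans by metis
      next
        case False
        then show ?thesis
          using y by blast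
      qed
      moreover have "restrict (P A) (underS \<alpha> x) e = P A e"
        using ex by simp
      ultimately have r: "P A x \<le> P A e \<and> P A x \<le> X \<and>
          (\<forall>i\<in>Field \<gamma>. h i = x \<longrightarrow> (\<exists>a\<in>A i. P A x \<le> a))"
        unfolding P[of A x] G_def some_e using False by (simp only: if_False) (rule someI_ex)
      have "P A x \<le> P A z" if "z \<in> underS \<alpha> x" for z
        using underS_immediate_succ[OF \<alpha> e(2) that] r IH[OF ex] order_trans by blast
      then show ?thesis
        using r by blast
    qed
  qed
  define \<sigma> where "\<sigma> i A c = (SOME a. a \<in> A i \<and> P A (h i) \<le> a)"
    for i and A :: "'g \<Rightarrow> 'q set" and c :: "'g \<Rightarrow> 'q"
  have P_restrict: "P (restrict A (under \<gamma> i)) (h i) = P A (h i)" if i: "i \<in> Field \<gamma>" for A i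
    unfolding P_def
  proof (rule worec_cong[OF \<alpha>])
    fix x p assume x: "x = h i \<or> x \<in> underS \<alpha> (h i)"
    have "restrict A (under \<gamma> i) j = A j" if j: "j \<in> Field \<gamma>" "h j = x" for j
    proof -
      have "i \<notin> underS \<gamma> j"
        using h_mono[OF j(1), of i] x j(2) underS_irrefl underS_trans[OF \<alpha>] by metis
      then have "j \<in> under \<gamma> i"
        using underS_trichotomy[OF wo i j(1)] under_eq[OF wo i] by blast
      then show ?thesis
        by simp
    qed
    then have "(\<forall>j\<in>Field \<gamma>. h j = x \<longrightarrow> (\<exists>a\<in>restrict A (under \<gamma> i) j. r \<le> a)) \<longleftrightarrow>
        (\<forall>j\<in>Field \<gamma>. h j = x \<longrightarrow> (\<exists>a\<in>A j. r \<le> a))" for r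
      by metis
    then show "G (restrict A (under \<gamma> i)) x p = G A x p"
      unfolding G_def by (simp only:)
  qed
  have "Choose_winning_strategy \<gamma> X \<sigma>"
    unfolding Choose_winning_strategy_def
  proof (intro allI impI)
    fix A c
    assume run: "(\<forall>i\<in>Field \<gamma>. max_antichain_below X (A i)) \<and>
      (\<forall>i\<in>Field \<gamma>. c i = \<sigma> i (restrict A (under \<gamma> i)) (restrict c (underS \<gamma> i)))"
    note play = play[of _ A]
    have c: "c i \<in> A i \<and> P A (h i) \<le> c i" if i: "i \<in> Field \<gamma>" for i
    proof -
      have "\<exists>a. a \<in> A i \<and> P A (h i) \<le> a"
        using play[OF odd_stage_Field[OF h_odd[OF i]]] run h_odd[OF i] i by blast
      moreover have "restrict A (under \<gamma> i) i = A i"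
        using under_eq[OF wo i] by simp
      then have "c i = (SOME a. a \<in> A i \<and> P A (h i) \<le> a)"
        using run i P_restrict[OF i, of A] unfolding \<sigma>_def by simp
      ultimately show ?thesis
        using someI_ex[of "\<lambda>a. a \<in> A i \<and> P A (h i) \<le> a"] by simp
    qed
    have "P A t \<le> P A (h i)" if "i \<in> Field \<gamma>" for i
      using play[OF even_stage_Field[OF t]] run h_t[OF that] by blast
    then have "\<forall>i\<in>Field \<gamma>. P A t \<le> c i"
      using c order_trans by blast
    then show "(\<forall>i\<in>Field \<gamma>. c i \<in> A i) \<and> (\<exists>q. \<forall>i\<in>Field \<gamma>. q \<le> c i)"
      using c by blast
  qed
  then show ?thesis
    unfolding Choose_wins_def by blast
qed

theorem corollary7p5:
  fixes \<kappa> :: "'k rel" and I :: "'k set set" and \<gamma> :: "'g rel"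
  assumes "Card_order \<kappa>" and "regularCard \<kappa>" and "natLeq <o \<kappa>"
    and "ideal_on (Field \<kappa>) I"
    and "limit_ordinal \<gamma>" and "\<gamma> <o \<kappa>"
  shows "less_succ_strategically_closed TYPE('q::order_top) \<gamma> \<longleftrightarrow>
         (\<forall>X :: 'q. Choose_wins X \<gamma>)"
proof
  have wo: "Well_order \<gamma>" and ne: "Field \<gamma> \<noteq> {}"
    using assms(5) by (auto simp: limit_ordinal_def)
  {
    assume closed: "less_succ_strategically_closed TYPE('q) \<gamma>"
    obtain \<alpha> :: "'g set rel" and h t where \<alpha>:
      "\<alpha> <o cardSuc |Field \<gamma>|" "even_stage \<alpha> t"
      "\<And>i. i \<in> Field \<gamma> \<Longrightarrow> odd_stage \<alpha> (h i)" "\<And>i. i \<in> Field \<gamma> \<Longrightarrow> h i \<in> underS \<alpha> t"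
      "\<And>i j. i \<in> Field \<gamma> \<Longrightarrow> j \<in> underS \<gamma> i \<Longrightarrow> h j \<in> underS \<alpha> (h i)"
      using odd_stage_embedding[OF wo limit_ordinal_infinite[OF assms(5)]] by metis
    have "Well_order \<alpha>"
      using \<alpha>(1) by (simp add: ordLess_def)
    moreover obtain \<tau> :: "'g set \<Rightarrow> ('g set \<Rightarrow> 'q) \<Rightarrow> 'q" where "Even_winning_strategy \<alpha> \<tau>"
      using closed \<alpha>(1) unfolding less_succ_strategically_closed_def strategically_closed_def by blast
    ultimately show "\<forall>X :: 'q. Choose_wins X \<gamma>"
      using Choose_wins_if_Even_wins[OF wo _ _ \<alpha>(2), of _ h] \<alpha>(3-5) by blast
  next
    assume wins: "\<forall>X :: 'q. Choose_wins X \<gamma>"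
    show "less_succ_strategically_closed TYPE('q) \<gamma>"
      unfolding less_succ_strategically_closed_def
    proof (intro allI impI)
      fix \<alpha> :: "'g set rel" assume \<alpha>: "\<alpha> <o cardSuc |Field \<gamma>|"
      have wo\<alpha>: "Well_order \<alpha>"
        using \<alpha> by (simp add: ordLess_def)
      have "|Field \<alpha>| <o cardSuc |Field \<gamma>|"
        using card_of_least[OF wo\<alpha>] \<alpha> ordLeq_ordLess_trans by blast
      then have small: "|Field \<alpha>| \<le>o |Field \<gamma>|"
        using cardSuc_ordLeq_ordLess[OF card_of_Card_order card_of_Card_order] by blast
      show "strategically_closed TYPE('q) \<alpha>"
      proof (rule strategically_closed_if_descent[OF wo\<alpha>])
        show "\<exists>\<tau>. descent_strategy \<alpha> S X \<tau>" if S: "S \<subseteq> Field \<alpha>" for S and X :: 'q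
        proof (rule descent_any_length[OF wo\<alpha> wo small _ S])
          show "\<exists>\<tau>. descent_strategy \<gamma> R X \<tau>" if "R \<subseteq> Field \<gamma>" for R and X :: 'q
            using descent_if_Choose_wins[OF wo ne _ that] wins by blast
        qed
      qed
    qed
  }
qed

end
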